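(* Let $K\in\mathcal{L}(Z,U)$ be such that $A+BK$ generates a bounded polynomially stable $C_0$-semigroup $T_{A+BK}(t)$ on $Z$, and let $L\in\mathcal{L}(W,U)$. The following are equivalent. (a) $BL+P$ is conform for the semigroup $T_{A+BK}(t)$, and the control law $u(t)=Kz(t)+Lw(t)$ solves the state feedback regulation problem (SFRP) with $$\|e(t)\|\le M t^{-\beta}\big[\|z_0\|_A+\|w_0\|_S\big]$$ for all $t>0$ and some $\beta,M>0$ not depending on the initial conditions $z_0\in D(A)$ and $w_0\in D(S)$. (b) $L=\Gamma-K\Pi$, where $\Pi\in\mathcal{L}(W,Z)$, with $\Pi(D(S))\subset D(A)$, and $\Gamma\in\mathcal{L}(W,U)$ satisfy the regulator equations $$A\Pi+B\Gamma+P=\Pi S\ \text{ in } D(S),\qquad C\Pi=Q\ \text{ in } W.$$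
   Context: Setting. $Z,U,Y,W$ are complex Banach spaces. The plant is $\dot z(t)=Az(t)+Bu(t)+\mathcal{U}_d(t)$, $y(t)=Cz(t)$, $t\ge 0$, $z(0)=z_0\in Z$, where $A$ generates a $C_0$-semigroup $T_A(t)$ on $Z$, $B\in\mathcal{L}(U,Z)$, $C\in\mathcal{L}(Z,Y)$. The exosystem is $\dot w(t)=Sw(t)$, $y_r(t)=Qw(t)$, $\mathcal{U}_d(t)=Pw(t)$, $t\in\mathbb{R}$, $w(0)=w_0\in W$, where $S$ generates an isometric $C_0$-group $T_S(t)$, $t\in\mathbb{R}$, on $W$, $P\in\mathcal{L}(W,Z)$, $Q\in\mathcal{L}(W,Y)$. Solutions are mild solutions. The tracking error is $e(t)=y(t)-y_r(t)=Cz(t)-Qw(t)$. For an operator $G$, $\|\cdot\|_G$ denotes the graph norm $\|x\|_G=\|x\|+\|Gx\|$ on $D(G)$. Polynomial stability. A $C_0$-semigroup $T(t)$ on $Z$ with generator $G$ is polynomially stable if there are constants $\alpha,\beta,N>0$ with $\|T(t)G_\mu^{-\alpha}\|\le N t^{-\beta}$ for all $t>0$, where $G_\mu=\mu I-G$ and $\mu$ is a fixed real number with $\|T(t)\|\le Me^{(\mu-\varepsilon)t}$ for some $M,\varepsilon>0$ and all $t\ge 0$ (the notion does not depend on $\mu$). It is bounded if $\sup_{t\ge0}\|T(t)\|<\infty$. For a bounded polynomially stable semigroup, $\sigma(G)\subset\{\mathrm{Re}\,\lambda<0\}$ and there are $\alpha,N>0$ with $\|T(t)(-G)^{-\alpha}\|\le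 N/t$ for all $t>0$, equivalently (with a possibly different $N$) $\|T(t)G^{-1}\|\le N t^{-1/\alpha}$ for all $t>0$. SFRP. A control law $u(t)=Kz(t)+Lw(t)$, with $K\in\mathcal{L}(Z,U)$ and $L\in\mathcal{L}(W,U)$, solves the SFRP if: (i) $A+BK$ generates a bounded polynomially stable $C_0$-semigroup $T_{A+BK}(t)$ on $Z$; (ii) for the extended closed loop system $\dot z(t)=(A+BK)z(t)+(BL+P)w(t)$, $\dot w(t)=Sw(t)$, $t\ge0$, the tracking error $e(t)=Cz(t)-Qw(t)$ tends to $0$ as $t\to\infty$ for all initial conditions $z_0\in Z$, $w_0\in W$, and for all $z_0\in D(A)$, $w_0\in D(S)$ there is $m>0$ (depending on the initial conditions) with $\|e(t)\|_Y\le m\,t^{-1/\alpha}$ for all $t>0$, where $\alpha$ is the exponent above for $G=A+BK$. Conform operator. For a polynomially stable $C_0$-semigroup $T(t)$ on $Z$, an operator $\Delta\in\mathcal{L}(W,Z)$ is conform for $T(t)$ if $w\mapsto\int_0^\infty T(t)\Delta T_S(-t)w\,dt$, $w\in D(S)$ (improper integral), defines a linear bounded operator from $D(S)$ to $Z$, where $D(S)$ is endowed with the norm induced by $W$. *)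

theory Defs
  imports "HOL-Analysis.Analysis"
begin

section \<open>Complex Banach spaces\<close>

class scaleC =
  fixes scaleC :: "complex \<Rightarrow> 'a \<Rightarrow> 'a" (infixr "*\<^sub>C" 75)

class complex_banach = banach + scaleC +
  assumes scaleC_add_right: "a *\<^sub>C (x + y) = a *\<^sub>C x + a *\<^sub>C y"
    and scaleC_add_left: "(a + b) *\<^sub>C x = a *\<^sub>C x + b *\<^sub>C x"
    and scaleC_scaleC: "a *\<^sub>C b *\<^sub>C x = (a * b) *\<^sub>C x"
    and scaleC_of_real: "complex_of_real r *\<^sub>C x = r *\<^sub>R x"
    and norm_scaleC: "norm (a *\<^sub>C x) = cmod a * norm x"

instantiation complex :: complex_banach
begin

definition scaleC_complex :: "complex \<Rightarrow> complex \<Rightarrow> complex" where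
  "scaleC_complex a x = a * x"

instance
  by standard (auto simp: scaleC_complex_def algebra_simps norm_mult scaleR_conv_of_real)

end

definition bounded_clinear :: "('a::complex_banach \<Rightarrow> 'b::complex_banach) \<Rightarrow> bool" where
  "bounded_clinear f \<longleftrightarrow> bounded_linear f \<and> (\<forall>c x. f (c *\<^sub>C x) = c *\<^sub>C f x)"


section \<open>Semigroups, groups and generators\<close>

text \<open>Semigroups are functions on all of \<open>real\<close> whose values at negative times are irrelevant.
  An unbounded operator is a domain \<open>D\<close> together with a function whose values outside \<open>D\<close>
  are irrelevant.\<close>

definition C0_semigroup :: "(real \<Rightarrow> 'z::complex_banach \<Rightarrow> 'z) \<Rightarrow> bool" where
  "C0_semigroup T \<longleftrightarrow>
     (\<forall>t\<ge>0. bounded_clinear (T t)) \<and>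
     (\<forall>x. T 0 x = x) \<and>
     (\<forall>s\<ge>0. \<forall>t\<ge>0. \<forall>x. T (s + t) x = T s (T t x)) \<and>
     (\<forall>x. ((\<lambda>t. T t x) \<longlongrightarrow> x) (at_right 0))"

definition generates_semigroup ::
  "'z::complex_banach set \<Rightarrow> ('z \<Rightarrow> 'z) \<Rightarrow> (real \<Rightarrow> 'z \<Rightarrow> 'z) \<Rightarrow> bool" where
  "generates_semigroup D G T \<longleftrightarrow>
     C0_semigroup T \<and>
     D = {x. \<exists>y. ((\<lambda>h. (T h x - x) /\<^sub>R h) \<longlongrightarrow> y) (at_right 0)} \<and>
     (\<forall>x\<in>D. ((\<lambda>h. (T h x - x) /\<^sub>R h) \<longlongrightarrow> G x) (at_right 0))"

definition C0_group :: "(real \<Rightarrow> 'w::complex_banach \<Rightarrow> 'w) \<Rightarrow> bool" where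
  "C0_group T \<longleftrightarrow>
     (\<forall>t. bounded_clinear (T t)) \<and>
     (\<forall>x. T 0 x = x) \<and>
     (\<forall>s t x. T (s + t) x = T s (T t x)) \<and>
     (\<forall>x. ((\<lambda>t. T t x) \<longlongrightarrow> x) (at 0))"

definition generates_group ::
  "'w::complex_banach set \<Rightarrow> ('w \<Rightarrow> 'w) \<Rightarrow> (real \<Rightarrow> 'w \<Rightarrow> 'w) \<Rightarrow> bool" where
  "generates_group D G T \<longleftrightarrow>
     C0_group T \<and>
     D = {x. \<exists>y. ((\<lambda>h. (T h x - x) /\<^sub>R h) \<longlongrightarrow> y) (at 0)} \<and>
     (\<forall>x\<in>D. ((\<lambda>h. (T h x - x) /\<^sub>R h) \<longlongrightarrow> G x) (at 0))"

definition isometric_group :: "(real \<Rightarrow> 'w::complex_banach \<Rightarrow> 'w) \<Rightarrow> bool" where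
  "isometric_group T \<longleftrightarrow> C0_group T \<and> (\<forall>t x. norm (T t x) = norm x)"

definition graph_norm :: "('a::complex_banach \<Rightarrow> 'b::complex_banach) \<Rightarrow> 'a \<Rightarrow> real" where
  "graph_norm G x = norm x + norm (G x)"


section \<open>Boundedness and polynomial stability\<close>

definition bounded_semigroup :: "(real \<Rightarrow> 'z::complex_banach \<Rightarrow> 'z) \<Rightarrow> bool" where
  "bounded_semigroup T \<longleftrightarrow> (\<exists>M. \<forall>t\<ge>0. onorm (T t) \<le> M)"

definition growth_below :: "(real \<Rightarrow> 'z::complex_banach \<Rightarrow> 'z) \<Rightarrow> real \<Rightarrow> bool" where
  "growth_below T \<mu> \<longleftrightarrow> (\<exists>M>0. \<exists>\<epsilon>>0. \<forall>t\<ge>0. onorm (T t) \<le> M * exp ((\<mu> - \<epsilon>) * t))"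

text \<open>The fractional power \<open>(\<mu> - G) powr -\<alpha>\<close>, where \<open>G\<close> generates \<open>T\<close> and \<open>growth_below T \<mu>\<close>:
  \<open>G - \<mu>\<close> then generates the exponentially stable semigroup \<open>exp (-\<mu>s) T(s)\<close>, and the negative
  power is given by the Gamma-function integral of this semigroup
  (for \<open>\<alpha> = 1\<close> it is the resolvent).\<close>

definition neg_frac_power ::
  "(real \<Rightarrow> 'z::complex_banach \<Rightarrow> 'z) \<Rightarrow> real \<Rightarrow> real \<Rightarrow> 'z \<Rightarrow> 'z" where
  "neg_frac_power T \<mu> \<alpha> x =
     (1 / Gamma \<alpha>) *\<^sub>R integral {0..} (\<lambda>s. (s powr (\<alpha> - 1) * exp (- \<mu> * s)) *\<^sub>R T s x)"

definition polynomially_stable :: "(real \<Rightarrow> 'z::complex_banach \<Rightarrow> 'z) \<Rightarrow> bool" where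
  "polynomially_stable T \<longleftrightarrow>
     (\<exists>\<mu>. growth_below T \<mu> \<and>
        (\<exists>\<alpha>>0. \<exists>\<beta>>0. \<exists>N>0. \<forall>t>0.
           onorm (\<lambda>x. T t (neg_frac_power T \<mu> \<alpha> x)) \<le> N * t powr (- \<beta>)))"

definition boundedly_invertible ::
  "'z::complex_banach set \<Rightarrow> ('z \<Rightarrow> 'z) \<Rightarrow> bool" where
  "boundedly_invertible D G \<longleftrightarrow> bij_betw G D UNIV \<and> bounded_clinear (inv_into D G)"

text \<open>\<open>\<alpha>\<close> is an exponent of polynomial decay of the semigroup \<open>T\<close> generated by \<open>G\<close>, in the form
  \<open>\<parallel>T(t) G\<^sup>-\<^sup>1\<parallel> \<le> N t powr (-1/\<alpha>)\<close>.\<close>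

definition decay_exponent ::
  "'z::complex_banach set \<Rightarrow> ('z \<Rightarrow> 'z) \<Rightarrow> (real \<Rightarrow> 'z \<Rightarrow> 'z) \<Rightarrow> real \<Rightarrow> bool" where
  "decay_exponent D G T \<alpha> \<longleftrightarrow>
     boundedly_invertible D G \<and> \<alpha> > 0 \<and>
     (\<exists>N>0. \<forall>t>0. onorm (\<lambda>x. T t (inv_into D G x)) \<le> N * t powr (- 1 / \<alpha>))"


section \<open>The closed loop system and the regulation problem\<close>

text \<open>First component of the mild solution of \<open>z' = G z + \<Delta> w\<close>, \<open>w' = S w\<close>, where \<open>G\<close> generates
  \<open>T\<close> and \<open>S\<close> generates \<open>TS\<close>; the second component is \<open>TS t w0\<close>.\<close>

definition mild_state ::
  "(real \<Rightarrow> 'z::complex_banach \<Rightarrow> 'z) \<Rightarrow> (real \<Rightarrow> 'w::complex_banach \<Rightarrow> 'w) \<Rightarrow> ('w \<Rightarrow> 'z)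
     \<Rightarrow> 'z \<Rightarrow> 'w \<Rightarrow> real \<Rightarrow> 'z" where
  "mild_state T TS \<Delta> z0 w0 t = T t z0 + integral {0..t} (\<lambda>s. T (t - s) (\<Delta> (TS s w0)))"

definition tracking_error ::
  "('z::complex_banach \<Rightarrow> 'y::complex_banach) \<Rightarrow> ('w::complex_banach \<Rightarrow> 'y)
     \<Rightarrow> (real \<Rightarrow> 'z \<Rightarrow> 'z) \<Rightarrow> (real \<Rightarrow> 'w \<Rightarrow> 'w) \<Rightarrow> ('w \<Rightarrow> 'z) \<Rightarrow> 'z \<Rightarrow> 'w \<Rightarrow> real \<Rightarrow> 'y" where
  "tracking_error C Q T TS \<Delta> z0 w0 t = C (mild_state T TS \<Delta> z0 w0 t) - Q (TS t w0)"

text \<open>\<open>T\<close> is the closed loop semigroup, i.e. the one generated by \<open>A + B K\<close> on \<open>D(A)\<close>. Decay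
  exponents are not unique; the decay rate of the error is required for each of them.\<close>

definition solves_SFRP ::
  "'z::complex_banach set \<Rightarrow> ('z \<Rightarrow> 'z) \<Rightarrow> ('u::complex_banach \<Rightarrow> 'z) \<Rightarrow> ('z \<Rightarrow> 'y::complex_banach)
     \<Rightarrow> 'w::complex_banach set \<Rightarrow> (real \<Rightarrow> 'w \<Rightarrow> 'w) \<Rightarrow> ('w \<Rightarrow> 'z) \<Rightarrow> ('w \<Rightarrow> 'y)
     \<Rightarrow> ('z \<Rightarrow> 'u) \<Rightarrow> ('w \<Rightarrow> 'u) \<Rightarrow> (real \<Rightarrow> 'z \<Rightarrow> 'z) \<Rightarrow> bool" where
  "solves_SFRP DA A B C DS TS P Q K L T \<longleftrightarrow>
     (let G = (\<lambda>z. A z + B (K z)); e = tracking_error C Q T TS (\<lambda>w. B (L w) + P w) in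
       bounded_clinear K \<and> bounded_clinear L \<and>
       generates_semigroup DA G T \<and> bounded_semigroup T \<and> polynomially_stable T \<and>
       (\<forall>z0 w0. (e z0 w0 \<longlongrightarrow> 0) at_top) \<and>
       (\<exists>\<alpha>. decay_exponent DA G T \<alpha>) \<and>
       (\<forall>\<alpha>. decay_exponent DA G T \<alpha> \<longrightarrow>
          (\<forall>z0\<in>DA. \<forall>w0\<in>DS. \<exists>m>0. \<forall>t>0. norm (e z0 w0 t) \<le> m * t powr (- 1 / \<alpha>))))"

definition conform ::
  "(real \<Rightarrow> 'z::complex_banach \<Rightarrow> 'z) \<Rightarrow> 'w::complex_banach set \<Rightarrow> (real \<Rightarrow> 'w \<Rightarrow> 'w)
     \<Rightarrow> ('w \<Rightarrow> 'z) \<Rightarrow> bool" where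
  "conform T DS TS \<Delta> \<longleftrightarrow> bounded_clinear \<Delta> \<and>
     (\<exists>J. (\<forall>w\<in>DS. ((\<lambda>\<tau>. integral {0..\<tau>} (\<lambda>t. T t (\<Delta> (TS (- t) w)))) \<longlongrightarrow> J w) at_top) \<and>
          (\<forall>v\<in>DS. \<forall>w\<in>DS. J (v + w) = J v + J w) \<and>
          (\<forall>c. \<forall>w\<in>DS. J (c *\<^sub>C w) = c *\<^sub>C J w) \<and>
          (\<exists>M. \<forall>w\<in>DS. norm (J w) \<le> M * norm w))"

end

theory Submission
  imports Defs
begin

text \<open>
  Let \<open>T\<close> be the closed loop semigroup, \<open>G = A + B K\<close> its generator and \<open>\<Delta> = B L + P\<close>. Substituting
  \<open>L = \<Gamma> - K \<Pi>\<close> turns the first regulator equation into the Sylvester equation \<open>G \<Pi> + \<Delta> = \<Pi> S\<close> on the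
  domain of \<open>S\<close>, and \<open>\<Gamma> = L + K \<Pi>\<close> goes back. A bounded solution \<open>\<Pi>\<close> straightens the extended system:
  since \<open>T (t - s) \<Delta> TS(s) w\<close> is the derivative of \<open>T (t - s) \<Pi> TS(s) w\<close> in \<open>s\<close>, the plant state is
  \<open>T t (z0 - \<Pi> w0) + \<Pi> TS(t) w0\<close> and the tracking error is
  \<open>C T t (z0 - \<Pi> w0) + (C \<Pi> - Q) TS(t) w0\<close> (\<open>sylvester_tracking_error\<close>).

  If \<open>\<Pi>\<close> and \<open>\<Gamma>\<close> solve the regulator equations, the second term vanishes. What remains tends to \<open>0\<close>
  because \<open>T\<close> is strongly stable, and it has the required rate because \<open>T t x = T t G\<^sup>-\<^sup>1 (G x)\<close> on the
  domain. The same rate gives \<open>T t \<Pi> TS(- t) w \<rightarrow> 0\<close>, so that the improper integral defining conformity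
  converges to \<open>\<Pi> w\<close> (\<open>sylvester_imp_conform\<close>).

  Conversely, the improper integral of a conform operator extends to a bounded operator \<open>\<Pi>\<close>, and
  shifting time in the integral shows that \<open>\<Pi>\<close> solves the Sylvester equation
  (\<open>conform_imp_sylvester\<close>). To find \<open>C \<Pi> = Q\<close>, start the exosystem at \<open>TS(- t) w\<close> and the plant at
  \<open>\<Pi> TS(- t) w\<close>: the error at time \<open>t\<close> is then \<open>(C \<Pi> - Q) w\<close>, whereas the graph norms of these initial
  states stay bounded in \<open>t\<close> because the group is isometric. The uniform decay rate forces the error to
  be \<open>0\<close>.

  The analytic input is that polynomial stability, which speaks of \<open>(\<mu> - G) powr - \<alpha>\<close> for one real \<open>\<alpha>\<close>,
  makes \<open>G\<close> boundedly invertible with \<open>T t G\<^sup>-\<^sup>1\<close> decaying polynomially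
  (\<open>polynomially_stable_decay_exponent\<close>). By the semigroup law of fractional powers (\<open>frac_frac\<close>) some
  integral power of the resolvent \<open>R = (\<mu> - G)\<^sup>-\<^sup>1\<close> decays under \<open>T\<close>; a Landau inequality for the
  generator brings the power down to \<open>R\<close> itself (\<open>resolvent_decay\<close>); and as soon as \<open>\<mu> T t R\<close> has norm
  below \<open>1\<close>, the identity \<open>1 - \<mu> T t R = G V\<close>, with a bounded operator \<open>V\<close>, yields the inverse of \<open>G\<close>
  (\<open>generator_invertible\<close>).
\<close>

section \<open>Semigroups and their generators\<close>

lemma has_vector_derivative_iff_quotient:
  fixes f :: "real \<Rightarrow> 'a::real_normed_vector"
  shows "(f has_vector_derivative y) (at t within X) \<longleftrightarrow>
    ((\<lambda>s. (f s - f t) /\<^sub>R (s - t)) \<longlongrightarrow> y) (at t within X)"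
proof -
  have "norm ((1 / norm (s - t)) *\<^sub>R (f s - (f t + (s - t) *\<^sub>R y)))
      = norm ((f s - f t) /\<^sub>R (s - t) - y)" if "s \<noteq> t" for s
  proof -
    have "(f s - f t) /\<^sub>R (s - t) - y = (f s - (f t + (s - t) *\<^sub>R y)) /\<^sub>R (s - t)"
      using that by (simp add: scaleR_diff_right scaleR_add_right)
    then show ?thesis
      by (simp add: divide_inverse mult.commute)
  qed
  then have "(\<forall>\<^sub>F s in at t within X. norm ((1 / norm (s - t)) *\<^sub>R (f s - (f t + (s - t) *\<^sub>R y)))
      = norm ((f s - f t) /\<^sub>R (s - t) - y))"
    by (auto simp: eventually_at_filter)
  then have "((\<lambda>s. norm ((1 / norm (s - t)) *\<^sub>R (f s - (f t + (s - t) *\<^sub>R y)))) \<longlongrightarrow> 0) (at t within X)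
    \<longleftrightarrow> ((\<lambda>s. norm ((f s - f t) /\<^sub>R (s - t) - y)) \<longlongrightarrow> 0) (at t within X)"
    by (rule tendsto_cong)
  then show ?thesis
    unfolding has_vector_derivative_def has_derivative_within Lim_null[of _ y]
    by (simp only: bounded_linear_scaleR_left tendsto_norm_zero_iff simp_thms)
qed

lemma bounded_linear_scaleC: "bounded_linear (\<lambda>x::'a::complex_banach. c *\<^sub>C x)"
proof (rule bounded_linear_intro[where K = "cmod c"])
  show "c *\<^sub>C (r *\<^sub>R x) = r *\<^sub>R (c *\<^sub>C x)" for r and x :: 'a
    by (metis scaleC_of_real scaleC_scaleC mult.commute)
qed (simp_all add: scaleC_add_right norm_scaleC)

locale bounded_C0_semigroup =
  fixes D :: "'z::complex_banach set" and G :: "'z \<Rightarrow> 'z" and T :: "real \<Rightarrow> 'z \<Rightarrow> 'z" and M :: real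
  assumes generates: "generates_semigroup D G T"
    and M_nonneg: "0 \<le> M"
    and norm_T: "0 \<le> t \<Longrightarrow> norm (T t x) \<le> M * norm x"
begin

lemma bounded_linear_T: "0 \<le> t \<Longrightarrow> bounded_linear (T t)"
  and T_scaleC: "0 \<le> t \<Longrightarrow> T t (c *\<^sub>C x) = c *\<^sub>C T t x"
  and T_zero [simp]: "T 0 x = x"
  and T_add: "0 \<le> s \<Longrightarrow> 0 \<le> t \<Longrightarrow> T (s + t) x = T s (T t x)"
  and T_tendsto: "((\<lambda>t. T t x) \<longlongrightarrow> x) (at_right 0)"
  using generates
  by (auto simp: generates_semigroup_def C0_semigroup_def bounded_clinear_def)

lemmas T_diff = bounded_linear.linear[OF bounded_linear_T, THEN linear_diff]
lemmas T_plus = bounded_linear.linear[OF bounded_linear_T, THEN linear_add]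
lemmas T_scaleR = bounded_linear.linear[OF bounded_linear_T, THEN linear_scale]

lemma T_commute: "0 \<le> s \<Longrightarrow> 0 \<le> t \<Longrightarrow> T s (T t x) = T t (T s x)"
  using T_add[of s t x] T_add[of t s x] by (simp add: add.commute)

lemma D_iff: "x \<in> D \<longleftrightarrow> (\<exists>y. ((\<lambda>h. (T h x - x) /\<^sub>R h) \<longlongrightarrow> y) (at_right 0))"
  and G_tendsto: "x \<in> D \<Longrightarrow> ((\<lambda>h. (T h x - x) /\<^sub>R h) \<longlongrightarrow> G x) (at_right 0)"
  using generates by (auto simp: generates_semigroup_def)

lemma generatorI:
  assumes "((\<lambda>h. (T h x - x) /\<^sub>R h) \<longlongrightarrow> y) (at_right 0)"
  shows "x \<in> D" "G x = y"
proof -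
  show "x \<in> D"
    using assms D_iff by blast
  then show "G x = y"
    using G_tendsto assms tendsto_unique trivial_limit_at_right_real by blast
qed

lemma eventually_at_right_0: "\<forall>\<^sub>F h in at_right 0. (0::real) < h"
  by (simp add: eventually_at_filter)

text \<open>A bounded operator that commutes with the semigroup commutes with its generator, because it
  can be pulled through the difference quotient.\<close>

lemma commute_generator:
  assumes E: "bounded_linear E" and comm: "\<And>t. 0 \<le> t \<Longrightarrow> E (T t x) = T t (E x)" and x: "x \<in> D"
  shows "E x \<in> D" "G (E x) = E (G x)"
proof -
  have "((\<lambda>h. E ((T h x - x) /\<^sub>R h)) \<longlongrightarrow> E (G x)) (at_right 0)"
    using bounded_linear.tendsto[OF E G_tendsto[OF x]] .
  moreover have "\<forall>\<^sub>F h in at_right 0. E ((T h x - x) /\<^sub>R h) = (T h (E x) - E x) /\<^sub>R h"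
    using eventually_at_right_0
    by eventually_elim
      (simp add: comm linear_diff[OF bounded_linear.linear[OF E]]
        linear_scale[OF bounded_linear.linear[OF E]])
  ultimately have "((\<lambda>h. (T h (E x) - E x) /\<^sub>R h) \<longlongrightarrow> E (G x)) (at_right 0)"
    by (rule Lim_transform_eventually)
  then show "E x \<in> D" "G (E x) = E (G x)"
    by (rule generatorI)+
qed

lemma T_in_D: "x \<in> D \<Longrightarrow> 0 \<le> t \<Longrightarrow> T t x \<in> D"
  and G_T: "x \<in> D \<Longrightarrow> 0 \<le> t \<Longrightarrow> G (T t x) = T t (G x)"
  by (intro commute_generator[of "T t"] bounded_linear_T; simp add: T_commute)+

lemma G_add:
  assumes "x \<in> D" "y \<in> D"
  shows "x + y \<in> D" "G (x + y) = G x + G y"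
proof -
  have "((\<lambda>h. (T h x - x) /\<^sub>R h + (T h y - y) /\<^sub>R h) \<longlongrightarrow> G x + G y) (at_right 0)"
    using assms by (intro tendsto_add G_tendsto)
  moreover have "\<forall>\<^sub>F h in at_right 0.
      (T h x - x) /\<^sub>R h + (T h y - y) /\<^sub>R h = (T h (x + y) - (x + y)) /\<^sub>R h"
    using eventually_at_right_0
    by eventually_elim (simp add: T_plus algebra_simps)
  ultimately have "((\<lambda>h. (T h (x + y) - (x + y)) /\<^sub>R h) \<longlongrightarrow> G x + G y) (at_right 0)"
    by (rule Lim_transform_eventually)
  then show "x + y \<in> D" "G (x + y) = G x + G y"
    by (rule generatorI)+
qed

lemma G_scaleR: "x \<in> D \<Longrightarrow> r *\<^sub>R x \<in> D" "x \<in> D \<Longrightarrow> G (r *\<^sub>R x) = r *\<^sub>R G x"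
  by (intro commute_generator[of "scaleR r"] bounded_linear_scaleR_right; simp add: T_scaleR)+

lemma G_scaleC: "x \<in> D \<Longrightarrow> c *\<^sub>C x \<in> D" "x \<in> D \<Longrightarrow> G (c *\<^sub>C x) = c *\<^sub>C G x"
  by (intro commute_generator[of "scaleC c"] bounded_linear_scaleC; simp add: T_scaleC)+

lemma G_minus: "x \<in> D \<Longrightarrow> - x \<in> D" "x \<in> D \<Longrightarrow> G (- x) = - G x"
  using G_scaleR[of x "-1"] by auto

lemma G_diff: "x \<in> D \<Longrightarrow> y \<in> D \<Longrightarrow> x - y \<in> D"
  "x \<in> D \<Longrightarrow> y \<in> D \<Longrightarrow> G (x - y) = G x - G y"
  using G_add[of x "- y"] G_minus by auto

text \<open>A uniform bound on the semigroup makes right continuity at \<open>0\<close> propagate to continuity at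
  every time, since increments of the orbit are images of increments at \<open>0\<close>.\<close>

lemma continuous_on_orbit: "continuous_on {0..} (\<lambda>t. T t x)"
proof (rule continuous_on_iff[THEN iffD2], intro ballI allI impI)
  fix t e :: real
  assume t: "t \<in> {0..}" and e: "0 < e"
  have "0 < e / (M + 1)"
    using e M_nonneg by simp
  from tendstoD[OF T_tendsto this] obtain d where d: "d > 0"
    and dT: "\<And>h. 0 < h \<Longrightarrow> h < d \<Longrightarrow> dist (T h x) x < e / (M + 1)"
    by (auto simp: eventually_at_right_field)
  have small: "norm (T a x - T b x) < e" if "0 \<le> a" "a \<le> b" "b - a < d" for a b
  proof (cases "a = b")
    case False
    have "norm (T b x - T a x) = norm (T a (T (b - a) x - x))"
      using that T_add[of a "b - a" x] by (simp add: T_diff)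
    also have "\<dots> \<le> M * norm (T (b - a) x - x)"
      using that norm_T by blast
    also have "\<dots> \<le> M * (e / (M + 1))"
      using that False dT[of "b - a"] M_nonneg
      by (intro mult_left_mono) (auto simp: dist_norm)
    also have "\<dots> < e"
      using e M_nonneg by (simp add: field_simps)
    finally show ?thesis
      by (simp add: norm_minus_commute)
  qed (use e in simp)
  show "\<exists>d>0. \<forall>s\<in>{0..}. dist s t < d \<longrightarrow> dist (T s x) (T t x) < e"
  proof (intro exI conjI ballI impI)
    fix s assume "s \<in> {0..}" "dist s t < d"
    then show "dist (T s x) (T t x) < e"
      using small[of s t] small[of t s] t
      by (cases "s \<le> t") (auto simp: dist_norm norm_minus_commute)
  qed (rule d)
qed

lemma tendsto_T:
  assumes f: "(f \<longlongrightarrow> t) F" and g: "(g \<longlongrightarrow> x) F" and pos: "\<forall>\<^sub>F s in F. 0 \<le> f s" and t: "0 \<le> t"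
  shows "((\<lambda>s. T (f s) (g s)) \<longlongrightarrow> T t x) F"
proof -
  have "continuous (at t within {0..}) (\<lambda>t. T t x)"
    using continuous_on_orbit t by (simp add: continuous_on_eq_continuous_within)
  then have "((\<lambda>s. T (f s) x) \<longlongrightarrow> T t x) F"
    using f pos by (intro continuous_within_tendsto_compose[of t "{0..}" "\<lambda>t. T t x"]) auto
  moreover have "((\<lambda>s. T (f s) (g s - x)) \<longlongrightarrow> 0) F"
  proof (rule Lim_null_comparison)
    show "\<forall>\<^sub>F s in F. norm (T (f s) (g s - x)) \<le> M * norm (g s - x)"
      using pos by eventually_elim (rule norm_T)
    show "((\<lambda>s. M * norm (g s - x)) \<longlongrightarrow> 0) F"
      using g by (intro tendsto_mult_right_zero tendsto_norm_zero) (simp add: LIM_zero)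
  qed
  ultimately have "((\<lambda>s. T (f s) x + T (f s) (g s - x)) \<longlongrightarrow> T t x + 0) F"
    by (rule tendsto_add)
  moreover have "\<forall>\<^sub>F s in F. T (f s) x + T (f s) (g s - x) = T (f s) (g s)"
    using pos by eventually_elim (simp add: T_diff)
  ultimately show ?thesis
    using Lim_transform_eventually by fastforce
qed

lemma continuous_on_T:
  assumes "continuous_on X f" "continuous_on X g" "\<And>s. s \<in> X \<Longrightarrow> 0 \<le> f s"
  shows "continuous_on X (\<lambda>s. T (f s) (g s))"
  unfolding continuous_on_def
proof
  fix s assume s: "s \<in> X"
  show "((\<lambda>s. T (f s) (g s)) \<longlongrightarrow> T (f s) (g s)) (at s within X)"
    using assms s by (intro tendsto_T) (auto simp: continuous_on_def eventually_at_filter)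
qed

lemma integrable_orbit: "0 \<le> a \<Longrightarrow> (\<lambda>s. T s x) integrable_on {a..b}"
  by (intro integrable_continuous_interval continuous_on_T continuous_intros) auto

lemma T_quotient_tendsto:
  assumes x: "x \<in> D" and t: "0 \<le> t"
  shows "((\<lambda>s. (T s x - T t x) /\<^sub>R (s - t)) \<longlongrightarrow> T t (G x)) (at t within {0..})"
proof -
  \<comment> \<open>On either side of \<open>t\<close> the quotient is \<open>T (min s t)\<close> applied to a forward quotient at \<open>0\<close>.\<close>
  have quot: "((\<lambda>s. (T \<bar>s - t\<bar> x - x) /\<^sub>R \<bar>s - t\<bar>) \<longlongrightarrow> G x) (at t within {0..})"
  proof (rule filterlim_compose[OF G_tendsto[OF x]])
    show "filterlim (\<lambda>s. \<bar>s - t\<bar>) (at_right 0) (at t within {0..})"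
      unfolding filterlim_at
      by (auto intro!: tendsto_eq_intros simp: eventually_at_filter)
  qed
  have "((\<lambda>s. T (min s t) ((T \<bar>s - t\<bar> x - x) /\<^sub>R \<bar>s - t\<bar>)) \<longlongrightarrow> T t (G x)) (at t within {0..})"
    using t by (intro tendsto_T[OF _ quot])
      (auto intro!: tendsto_eq_intros simp: eventually_at_filter)
  moreover have "\<forall>\<^sub>F s in at t within {0..}.
      T (min s t) ((T \<bar>s - t\<bar> x - x) /\<^sub>R \<bar>s - t\<bar>) = (T s x - T t x) /\<^sub>R (s - t)"
  proof -
    have flip: "(- a) /\<^sub>R (- b) = a /\<^sub>R b" for a :: 'z and b :: real
      by simp
    have "T (min s t) ((T \<bar>s - t\<bar> x - x) /\<^sub>R \<bar>s - t\<bar>) = (T s x - T t x) /\<^sub>R (s - t)"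
      if "s \<noteq> t" "0 \<le> s" for s
    proof (cases "s \<le> t")
      case True
      then have "T s (T (t - s) x) = T t x"
        using that T_add[of s "t - s" x] by simp
      then show ?thesis
        using True that flip[of "t - s" "T t x - T s x"] by (simp add: T_scaleR T_diff min_def)
    next
      case False
      then have "T t (T (s - t) x) = T s x"
        using t T_add[of t "s - t" x] by simp
      then show ?thesis
        using False t by (simp add: T_scaleR T_diff min_def)
    qed
    then show ?thesis
      by (auto simp: eventually_at_filter)
  qed
  ultimately show ?thesis
    by (rule Lim_transform_eventually)
qed

lemma orbit_has_vector_derivative:
  assumes "x \<in> D" "0 \<le> t"
  shows "((\<lambda>s. T s x) has_vector_derivative T t (G x)) (at t within {0..})"
  using T_quotient_tendsto[OF assms] by (simp add: has_vector_derivative_iff_quotient)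

lemma orbit_has_vector_derivative_at:
  assumes "x \<in> D" "0 < t"
  shows "((\<lambda>s. T s x) has_vector_derivative T t (G x)) (at t)"
  using orbit_has_vector_derivative[of x t] assms at_within_interior[of t "{0..}"] by simp

lemma orbit_increment_has_integral:
  assumes "x \<in> D" "0 \<le> t"
  shows "((\<lambda>s. T s (G x)) has_integral (T t x - x)) {0..t}"
proof (rule fundamental_theorem_of_calculus[of 0 t "\<lambda>s. T s x", unfolded T_zero])
  show "((\<lambda>s. T s x) has_vector_derivative T s (G x)) (at s within {0..t})" if "s \<in> {0..t}" for s
    using orbit_has_vector_derivative[OF assms(1), of s] that
    by (auto intro: has_vector_derivative_within_subset)
qed (rule assms)

lemma norm_orbit_increment:
  assumes "x \<in> D" "0 \<le> t"
  shows "norm (T t x - x) \<le> t * (M * norm (G x))"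
proof -
  have "norm (integral {0..t} (\<lambda>s. T s (G x))) \<le> M * norm (G x) * (t - 0)"
    using assms norm_T by (intro integral_bound continuous_on_T continuous_intros) auto
  then show ?thesis
    using orbit_increment_has_integral[OF assms] by (simp add: integral_unique mult.commute)
qed

text \<open>The integral of an orbit is smoother than the orbit: its difference quotient is a difference
  of two averages over intervals of length \<open>h\<close>, which converge to the values at the end points.\<close>

lemma integral_orbit_in_D:
  assumes t: "0 \<le> t"
  shows "integral {0..t} (\<lambda>s. T s x) \<in> D" "G (integral {0..t} (\<lambda>s. T s x)) = T t x - x"
proof -
  define F where "F u = integral {0..u} (\<lambda>s. T s x)" for u
  have F_deriv: "(F has_vector_derivative T a x) (at a within {a..a + 1})" if "0 \<le> a" for a
    unfolding F_def
    using that by (intro has_vector_derivative_within_subset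
        [OF integral_has_vector_derivative[of 0 "a + 1" "\<lambda>s. T s x" a]] continuous_on_T
        continuous_intros) auto
  have lim: "((\<lambda>h. (F (a + h) - F a) /\<^sub>R h) \<longlongrightarrow> T a x) (at_right 0)" if "0 \<le> a" for a
  proof -
    have "((\<lambda>s. (F s - F a) /\<^sub>R (s - a)) \<longlongrightarrow> T a x) (at a within {a..a + 1})"
      using F_deriv[OF that] by (simp add: has_vector_derivative_iff_quotient)
    then have "((\<lambda>s. (F s - F a) /\<^sub>R (s - a)) \<longlongrightarrow> T a x) (at_right a)"
      by (simp add: at_within_Icc_at_right)
    then show ?thesis
      by (simp add: filterlim_at_right_to_0[of _ _ a] add.commute)
  qed
  have shift: "T h (F t) = F (t + h) - F h" if "0 < h" for h
  proof -
    have "T h (F t) = integral {0..t} (\<lambda>s. T h (T s x))"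
      unfolding F_def using that
      by (intro integral_linear[OF integrable_orbit bounded_linear_T, unfolded o_def, symmetric]) auto
    also have "\<dots> = integral {0..t} (\<lambda>s. T (s + h) x)"
      using that by (intro integral_cong) (simp add: T_add[symmetric] add.commute)
    also have "\<dots> = integral {h..t + h} (\<lambda>s. T s x)"
      using integral_shift_real_ivl[of h h "t + h" "\<lambda>s. T s x"]
      by simp
    also have "\<dots> = F (t + h) - F h"
      unfolding F_def
      using Henstock_Kurzweil_Integration.integral_combine[of 0 h "t + h" "\<lambda>s. T s x"] that t
        integrable_orbit[of 0 x "t + h"] by (simp add: algebra_simps)
    finally show ?thesis .
  qed
  have "((\<lambda>h. (F (t + h) - F t) /\<^sub>R h - (F (0 + h) - F 0) /\<^sub>R h) \<longlongrightarrow> T t x - T 0 x) (at_right 0)"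
    using t by (intro tendsto_diff lim) auto
  moreover have "\<forall>\<^sub>F h in at_right 0.
      (F (t + h) - F t) /\<^sub>R h - (F (0 + h) - F 0) /\<^sub>R h = (T h (F t) - F t) /\<^sub>R h"
    using eventually_at_right_0
    by eventually_elim (simp add: shift, simp add: F_def algebra_simps)
  ultimately have "((\<lambda>h. (T h (F t) - F t) /\<^sub>R h) \<longlongrightarrow> T t x - x) (at_right 0)"
    using Lim_transform_eventually by force
  then show "integral {0..t} (\<lambda>s. T s x) \<in> D" "G (integral {0..t} (\<lambda>s. T s x)) = T t x - x"
    unfolding F_def by (rule generatorI)+
qed

lemma orbit_average_tendsto: "((\<lambda>h. integral {0..h} (\<lambda>s. T s x) /\<^sub>R h) \<longlongrightarrow> x) (at_right 0)"
proof -
  have "((\<lambda>h. integral {0..h} (\<lambda>s. T s x)) has_vector_derivative T 0 x) (at 0 within {0..1})"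
    by (intro integral_has_vector_derivative continuous_on_T continuous_intros) auto
  then show ?thesis
    by (simp add: has_vector_derivative_iff_quotient at_within_Icc_at_right)
qed

lemma D_dense: "closure D = UNIV"
proof -
  have "x \<in> closure D" for x
  proof (rule Lim_in_closed_set[OF closed_closure _ _ orbit_average_tendsto])
    show "\<forall>\<^sub>F h in at_right 0. integral {0..h} (\<lambda>s. T s x) /\<^sub>R h \<in> closure D"
      using eventually_at_right_0
    proof eventually_elim
      fix h :: real assume "0 < h"
      then have "integral {0..h} (\<lambda>s. T s x) /\<^sub>R h \<in> D"
        by (intro G_scaleR integral_orbit_in_D) simp
      then show "integral {0..h} (\<lambda>s. T s x) /\<^sub>R h \<in> closure D"
        using closure_subset by blast
    qed
  qed simp
  then show ?thesis
    by blast
qed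

lemma D_approx: "\<exists>u. (\<forall>n. u n \<in> D) \<and> u \<longlonglongrightarrow> x"
  using closure_sequential[of x D] D_dense by simp

text \<open>The integral form \<open>T h x - x = integral {0..h} (\<lambda>s. T s (G x))\<close> of the definition of the generator
  passes to the limit.\<close>

lemma generator_closed:
  assumes u: "\<And>n. u n \<in> D" and lim: "u \<longlonglongrightarrow> x" and Glim: "(\<lambda>n. G (u n)) \<longlonglongrightarrow> y"
  shows "x \<in> D" "G x = y"
proof -
  have eq: "T h x - x = integral {0..h} (\<lambda>s. T s y)" if h: "0 \<le> h" for h
  proof -
    have "(\<lambda>n. T h (u n) - u n) \<longlonglongrightarrow> T h x - x"
      using h by (intro tendsto_diff lim bounded_linear.tendsto[OF bounded_linear_T])
    moreover have "(\<lambda>n. T h (u n) - u n) \<longlonglongrightarrow> integral {0..h} (\<lambda>s. T s y)"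
    proof (rule LIM_zero_cancel, rule Lim_null_comparison)
      have "norm (T h (u n) - u n - integral {0..h} (\<lambda>s. T s y)) \<le> h * (M * norm (G (u n) - y))" for n
      proof -
        have "((\<lambda>s. T s (G (u n)) - T s y) has_integral
            (T h (u n) - u n - integral {0..h} (\<lambda>s. T s y))) {0..h}"
          by (intro has_integral_diff orbit_increment_has_integral u h integrable_integral
              integrable_orbit) simp
        then have "((\<lambda>s. T s (G (u n) - y)) has_integral
            (T h (u n) - u n - integral {0..h} (\<lambda>s. T s y))) {0..h}"
          by (rule has_integral_eq[rotated]) (simp add: T_diff)
        from has_integral_bound[OF _ this[unfolded cbox_interval[symmetric]],
            of "M * norm (G (u n) - y)"]
        show ?thesis
          using norm_T M_nonneg h by (simp add: mult.commute)
      qed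
      then show "\<forall>\<^sub>F n in sequentially. norm (T h (u n) - u n - integral {0..h} (\<lambda>s. T s y))
          \<le> h * (M * norm (G (u n) - y))"
        by simp
      show "(\<lambda>n. h * (M * norm (G (u n) - y))) \<longlonglongrightarrow> 0"
        using Glim by (intro tendsto_mult_right_zero tendsto_norm_zero) (simp add: LIM_zero)
    qed
    ultimately show ?thesis
      by (rule LIMSEQ_unique)
  qed
  have "\<forall>\<^sub>F h in at_right 0. integral {0..h} (\<lambda>s. T s y) /\<^sub>R h = (T h x - x) /\<^sub>R h"
    using eventually_at_right_0 by eventually_elim (simp add: eq)
  with orbit_average_tendsto have "((\<lambda>h. (T h x - x) /\<^sub>R h) \<longlongrightarrow> y) (at_right 0)"
    by (rule Lim_transform_eventually)
  then show "x \<in> D" "G x = y"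
    by (rule generatorI)+
qed

end

section \<open>Fractional integrals of an exponentially decaying orbit\<close>

lemma integrable_on_halfline:
  fixes f :: "real \<Rightarrow> 'a::banach"
  assumes f: "\<And>b. f integrable_on {c..b}" and le: "\<And>s. c \<le> s \<Longrightarrow> norm (f s) \<le> g s"
    and g: "g integrable_on {c..}"
  shows "f integrable_on {c..}"
proof (rule integrable_on_all_intervals_integrable_bound[OF _ _ g])
  show "(\<lambda>s. if s \<in> {c..} then f s else 0) integrable_on cbox a b" for a b
  proof -
    have "f integrable_on {max c a..b}"
      using f[of b] by (rule integrable_on_subinterval) auto
    moreover have "{c..} \<inter> cbox a b = {max c a..b}"
      by auto
    ultimately show ?thesis
      by (simp only: integrable_restrict_Int)
  qed
qed (use le in auto)

lemma integral_tendsto_halfline: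
  fixes f :: "real \<Rightarrow> 'a::banach"
  assumes "f integrable_on {0..}"
  shows "((\<lambda>X. integral {0..X} f) \<longlongrightarrow> integral {0..} f) at_top"
proof (rule tendstoI)
  fix e :: real assume "0 < e"
  then obtain B where B: "0 < B" and less: "\<And>a b. ball 0 B \<subseteq> cbox a b \<Longrightarrow>
      norm (integral (cbox a b) (\<lambda>s. if s \<in> {0..} then f s else 0) - integral {0..} f) < e"
    using integrable_integral[OF assms] unfolding has_integral_alt' by meson
  have "dist (integral {0..X} f) (integral {0..} f) < e" if "B \<le> X" for X
  proof -
    have "ball 0 B \<subseteq> cbox (- X) X"
      using that by (auto simp: dist_norm)
    moreover have "{0..} \<inter> cbox (- X) X = {0..X}"
      using that B by auto
    ultimately show ?thesis
      using less[of "- X" X] by (simp only: integral_restrict_Int dist_norm)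
  qed
  then show "\<forall>\<^sub>F X in at_top. dist (integral {0..X} f) (integral {0..} f) < e"
    by (auto simp: eventually_at_top_linorder)
qed

text \<open>The substitution \<open>v = s powr a\<close> absorbs the singularity of the kernel at \<open>0\<close>: an
  antiderivative of the integrand is obtained from one of the continuous function
  \<open>v \<mapsto> f (v powr (1/a))\<close>.\<close>

lemma powr_kernel_integrable:
  fixes f :: "real \<Rightarrow> 'a::banach"
  assumes a: "0 < a" and f: "continuous_on {0..b} f"
  shows "(\<lambda>s. s powr (a - 1) *\<^sub>R f s) integrable_on {0..b}"
proof (cases "0 \<le> b")
  case True
  define F where "F u = integral {0..u} (\<lambda>v. f (v powr (1 / a)))" for u
  have root: "v powr (1 / a) \<in> {0..b}" if "v \<in> {0..b powr a}" for v
  proof -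
    have "v powr (1 / a) \<le> (b powr a) powr (1 / a)"
      using that a by (intro powr_mono2) auto
    then show ?thesis
      using a True by (simp add: powr_powr)
  qed
  have cont: "continuous_on {0..b powr a} (\<lambda>v. f (v powr (1 / a)))"
    using a root by (intro continuous_on_compose2[OF f] continuous_on_powr' continuous_intros) auto
  have F_deriv: "(F has_vector_derivative f (u powr (1 / a))) (at u within {0..b powr a})"
    if "u \<in> {0..b powr a}" for u
    unfolding F_def using cont that by (rule integral_has_vector_derivative)
  have F_cont: "continuous_on {0..b powr a} F"
    using F_deriv by (rule continuous_on_vector_derivative)
  have powr_range: "s powr a \<in> {0..b powr a}" if "s \<in> {0..b}" for s
    using that a by (auto intro!: powr_mono2)
  have "((\<lambda>s. s powr (a - 1) *\<^sub>R f s) has_integral (1 / a) *\<^sub>R F (b powr a) - (1 / a) *\<^sub>R F (0 powr a))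
      {0..b}"
  proof (rule fundamental_theorem_of_calculus_interior[OF True,
        where f = "\<lambda>s. (1 / a) *\<^sub>R F (s powr a)"])
    show "continuous_on {0..b} (\<lambda>s. (1 / a) *\<^sub>R F (s powr a))"
      using a powr_range
      by (intro continuous_intros continuous_on_compose2[OF F_cont] continuous_on_powr') auto
    show "((\<lambda>s. (1 / a) *\<^sub>R F (s powr a)) has_vector_derivative s powr (a - 1) *\<^sub>R f s) (at s)"
      if s: "s \<in> {0<..<b}" for s
    proof -
      have "s powr a \<in> {0<..<b powr a}"
        using s a by (auto intro: powr_less_mono2)
      then have "(F has_vector_derivative f ((s powr a) powr (1 / a))) (at (s powr a))"
        using F_deriv[of "s powr a"] at_within_Icc_at[of 0 "s powr a" "b powr a"] by simp
      then have "(F has_vector_derivative f s) (at (s powr a))"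
        using s a by (simp add: powr_powr)
      moreover have "((\<lambda>s. s powr a) has_real_derivative a * s powr (a - 1)) (at s)"
        using s by (auto intro!: derivative_eq_intros)
      ultimately have "(F \<circ> (\<lambda>s. s powr a) has_vector_derivative (a * s powr (a - 1)) *\<^sub>R f s) (at s)"
        by (intro vector_diff_chain_at)
          (simp_all add: has_real_derivative_iff_has_vector_derivative)
      then have "((\<lambda>s. (1 / a) *\<^sub>R F (s powr a)) has_vector_derivative
          (1 / a) *\<^sub>R (a * s powr (a - 1)) *\<^sub>R f s) (at s)"
        unfolding o_def
        by (rule bounded_linear.has_vector_derivative[OF bounded_linear_scaleR_right])
      then show ?thesis
        using a by simp
    qed
  qed
  then show ?thesis
    by blast
qed (simp add: integrable_on_empty)

lemma powr_exp_integrable: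
  fixes a e :: real
  assumes "0 < a" "0 < e"
  shows "(\<lambda>s. s powr (a - 1) * exp (- e * s)) integrable_on {0..}"
proof -
  have "(\<lambda>s. norm (complex_of_real s powr (complex_of_real a - 1) / of_real (exp (e * s))))
      integrable_on {0<..}"
    using absolutely_integrable_Gamma_integral[of "complex_of_real a" e] assms
    by (simp add: absolutely_integrable_on_def)
  then have "(\<lambda>s. s powr (a - 1) * exp (- e * s)) integrable_on {0<..}"
    by (rule integrable_eq) (simp add: norm_divide norm_powr_real_powr exp_minus field_simps)
  then show ?thesis
    by (rule integrable_spike_set) (auto intro: negligible_subset[of "{0}"])
qed

text \<open>Scaling by \<open>u\<close> reduces the convolution of two power kernels to Euler's integral over \<open>{0..1}\<close>.\<close>

lemma powr_convolution_has_integral: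
  fixes a b u :: real
  assumes "0 < a" "0 < b" "0 < u"
  shows "((\<lambda>r. r powr (a - 1) * (u - r) powr (b - 1)) has_integral Beta a b * u powr (a + b - 1)) {0..u}"
proof -
  have "((\<lambda>r. (1 / u * r) powr (a - 1) * (1 - 1 / u * r) powr (b - 1)) has_integral
      (1 / \<bar>1 / u\<bar>) *\<^sub>R Beta a b) ((\<lambda>x. x / (1 / u)) ` {0..1})"
    using assms by (intro has_integral_stretch_real has_integral_Beta_real) auto
  moreover have "(\<lambda>x. x / (1 / u)) ` {0..1} = {0..u}"
    using assms image_mult_atLeastAtMost[of u 0 1] by (simp add: mult.commute)
  ultimately have "((\<lambda>r. (1 / u * r) powr (a - 1) * (1 - 1 / u * r) powr (b - 1)) has_integral
      u * Beta a b) {0..u}"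
    using assms by simp
  then have "((\<lambda>r. u powr (a + b - 2) * ((1 / u * r) powr (a - 1) * (1 - 1 / u * r) powr (b - 1)))
      has_integral u powr (a + b - 2) * (u * Beta a b)) {0..u}"
    by (rule has_integral_mult_right)
  moreover have "u powr (a + b - 2) * (u * Beta a b) = Beta a b * u powr (a + b - 1)"
    using assms powr_mult_base[of u "a + b - 2"] by (simp add: algebra_simps)
  moreover have "u powr (a + b - 2) * ((1 / u * r) powr (a - 1) * (1 - 1 / u * r) powr (b - 1))
      = r powr (a - 1) * (u - r) powr (b - 1)" if "r \<in> {0..u}" for r
  proof -
    have "1 - 1 / u * r = 1 / u * (u - r)"
      using assms by (simp add: field_simps)
    then have "(1 / u * r) powr (a - 1) * (1 - 1 / u * r) powr (b - 1)
        = (1 / u) powr (a - 1) * (1 / u) powr (b - 1) * (r powr (a - 1) * (u - r) powr (b - 1))"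
      using that assms by (simp add: powr_mult powr_divide)
    moreover have "u powr (a + b - 2) * ((1 / u) powr (a - 1) * (1 / u) powr (b - 1)) = 1"
      using assms by (simp add: powr_divide powr_add[symmetric])
    ultimately show ?thesis
      by (metis mult.assoc mult_1)
  qed
  ultimately show ?thesis
    by (metis (no_types, lifting) has_integral_eq)
qed

text \<open>The growth bound says that \<open>exp (- \<mu> t) T t\<close> decays exponentially, at rate \<open>\<epsilon>\<close>; the real
  number \<open>\<mu>\<close> may have any sign.\<close>

locale rescaled_semigroup = bounded_C0_semigroup D G T M
  for D :: "'z::complex_banach set" and G T M +
  fixes \<mu> \<epsilon> M' :: real
  assumes \<epsilon>_pos: "0 < \<epsilon>" and M'_nonneg: "0 \<le> M'"
    and growth: "0 \<le> t \<Longrightarrow> norm (T t x) \<le> M' * exp ((\<mu> - \<epsilon>) * t) * norm x"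
begin

definition integrand :: "real \<Rightarrow> 'z \<Rightarrow> real \<Rightarrow> 'z" where
  "integrand a x s = (s powr (a - 1) * exp (- \<mu> * s)) *\<^sub>R T s x"

text \<open>This is \<open>Gamma a\<close> times the fractional power \<open>(\<mu> - G) powr -a\<close>; leaving out the
  normalisation keeps the constants below elementary.\<close>

definition frac :: "real \<Rightarrow> 'z \<Rightarrow> 'z" where
  "frac a x = integral {0..} (integrand a x)"

lemma neg_frac_power_eq: "neg_frac_power T \<mu> a x = (1 / Gamma a) *\<^sub>R frac a x"
  unfolding neg_frac_power_def frac_def integrand_def by simp

lemma norm_rescaled: "0 \<le> t \<Longrightarrow> norm (exp (- \<mu> * t) *\<^sub>R T t x) \<le> M' * exp (- \<epsilon> * t) * norm x"
proof -
  assume t: "0 \<le> t"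
  have "exp (- \<mu> * t) * norm (T t x) \<le> exp (- \<mu> * t) * (M' * exp ((\<mu> - \<epsilon>) * t) * norm x)"
    using growth[OF t, of x] by (intro mult_left_mono) auto
  also have "exp (- \<mu> * t) * (M' * exp ((\<mu> - \<epsilon>) * t) * norm x)
      = M' * (exp (- \<mu> * t) * exp ((\<mu> - \<epsilon>) * t)) * norm x"
    by simp
  also have "exp (- \<mu> * t) * exp ((\<mu> - \<epsilon>) * t) = exp (- \<epsilon> * t)"
    unfolding mult_exp_exp by (simp add: algebra_simps)
  finally show ?thesis
    by simp
qed

lemma norm_integrand:
  assumes "0 \<le> s"
  shows "norm (integrand a x s) \<le> (s powr (a - 1) * exp (- \<epsilon> * s)) * (M' * norm x)"
proof -
  have "norm (integrand a x s) = s powr (a - 1) * norm (exp (- \<mu> * s) *\<^sub>R T s x)"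
    by (simp add: integrand_def)
  also have "\<dots> \<le> s powr (a - 1) * (M' * exp (- \<epsilon> * s) * norm x)"
    using norm_rescaled[OF assms] by (intro mult_left_mono) auto
  finally show ?thesis
    by (simp add: algebra_simps)
qed

lemma integrand_integrable_Icc:
  assumes "0 < a"
  shows "integrand a x integrable_on {0..b}"
proof -
  have "continuous_on {0..b} (\<lambda>s. exp (- \<mu> * s) *\<^sub>R T s x)"
    by (intro continuous_on_T continuous_intros) auto
  from powr_kernel_integrable[OF assms this] show ?thesis
    by (simp add: integrand_def[abs_def])
qed

lemma integrand_integrable:
  assumes "0 < a"
  shows "integrand a x integrable_on {0..}"
  by (rule integrable_on_halfline[OF integrand_integrable_Icc[OF assms] norm_integrand])
    (assumption, intro integrable_on_mult_left powr_exp_integrable assms \<epsilon>_pos)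

lemmas frac_tendsto = integral_tendsto_halfline[OF integrand_integrable, folded frac_def]

lemma norm_frac:
  assumes "0 < a"
  shows "norm (frac a x) \<le> norm x * (M' * integral {0..} (\<lambda>s. s powr (a - 1) * exp (- \<epsilon> * s)))"
proof -
  have "norm (frac a x) \<le> integral {0..} (\<lambda>s. (s powr (a - 1) * exp (- \<epsilon> * s)) * (M' * norm x))"
    unfolding frac_def using norm_integrand assms \<epsilon>_pos
    by (intro integral_norm_bound_integral integrand_integrable integrable_on_mult_left
        powr_exp_integrable) auto
  then show ?thesis
    by (simp add: algebra_simps)
qed

lemma bounded_linear_frac:
  assumes "0 < a"
  shows "bounded_linear (frac a)"
proof (rule bounded_linear_intro)
  show "frac a (x + y) = frac a x + frac a y" for x y
  proof -
    have "frac a (x + y) = integral {0..} (\<lambda>s. integrand a x s + integrand a y s)"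
      unfolding frac_def by (intro integral_cong) (simp add: integrand_def T_plus scaleR_add_right)
    then show ?thesis
      unfolding frac_def using assms by (simp add: integral_add integrand_integrable)
  qed
  show "frac a (r *\<^sub>R x) = r *\<^sub>R frac a x" for r x
  proof -
    have "frac a (r *\<^sub>R x) = integral {0..} (\<lambda>s. r *\<^sub>R integrand a x s)"
      unfolding frac_def by (intro integral_cong) (simp add: integrand_def T_scaleR)
    then show ?thesis
      unfolding frac_def by simp
  qed
qed (rule norm_frac[OF assms])

lemma frac_commute:
  assumes a: "0 < a" and E: "bounded_linear E" and comm: "\<And>t x. 0 \<le> t \<Longrightarrow> E (T t x) = T t (E x)"
  shows "E (frac a x) = frac a (E x)"
proof -
  have "E (frac a x) = integral {0..} (E \<circ> integrand a x)"
    unfolding frac_def by (rule integral_linear[OF integrand_integrable[OF a] E, symmetric])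
  also have "\<dots> = frac a (E x)"
    unfolding frac_def
    by (intro integral_cong)
      (simp add: integrand_def comm linear_scale[OF bounded_linear.linear[OF E]])
  finally show ?thesis .
qed

lemma frac_T: "0 < a \<Longrightarrow> 0 \<le> t \<Longrightarrow> frac a (T t x) = T t (frac a x)"
  by (intro frac_commute[symmetric] bounded_linear_T T_commute)

lemma frac_in_D: "0 < a \<Longrightarrow> x \<in> D \<Longrightarrow> frac a x \<in> D"
  and G_frac: "0 < a \<Longrightarrow> x \<in> D \<Longrightarrow> G (frac a x) = frac a (G x)"
  by (intro commute_generator[of "frac a"] bounded_linear_frac; simp add: frac_T)+

lemma orbit_rescaled_tendsto:
  assumes "0 \<le> c"
  shows "((\<lambda>X. (X powr c * exp (- \<mu> * X)) *\<^sub>R T X x) \<longlongrightarrow> 0) at_top"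
proof (rule Lim_null_comparison)
  show "\<forall>\<^sub>F X in at_top. norm ((X powr c * exp (- \<mu> * X)) *\<^sub>R T X x)
      \<le> (X powr c * exp (- \<epsilon> * X)) * (M' * norm x)"
    using eventually_ge_at_top[of 0] 
  proof eventually_elim
    case (elim X)
    then show ?case
      using norm_integrand[of X "c + 1" x] by (simp add: integrand_def)
  qed
  have "((\<lambda>X. X powr c * exp (- \<epsilon> * X)) \<longlongrightarrow> 0) at_top"
    using \<epsilon>_pos by real_asymp
  then show "((\<lambda>X. (X powr c * exp (- \<epsilon> * X)) * (M' * norm x)) \<longlongrightarrow> 0) at_top"
    by (rule tendsto_mult_left_zero)
qed

text \<open>Integration by parts of \<open>s powr a * exp (- \<mu> s) T s x\<close> raises the exponent by one.\<close>

lemma frac_by_parts: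
  assumes a: "0 < a" and x: "x \<in> D"
  shows "frac (a + 1) (\<mu> *\<^sub>R x - G x) = a *\<^sub>R frac a x"
proof -
  define f where "f s = (s powr a * exp (- \<mu> * s)) *\<^sub>R T s x" for s
  define f' where "f' s = a *\<^sub>R integrand a x s - integrand (a + 1) (\<mu> *\<^sub>R x - G x) s" for s
  have "(f' has_integral f X - f 0) {0..X}" if "0 \<le> X" for X
  proof (rule fundamental_theorem_of_calculus_interior[OF that])
    show "continuous_on {0..X} f"
      unfolding f_def using a
      by (intro continuous_intros continuous_on_powr' continuous_on_T) auto
    show "(f has_vector_derivative f' s) (at s)" if s: "s \<in> {0<..<X}" for s
    proof -
      have "((\<lambda>s. s powr a * exp (- \<mu> * s)) has_real_derivative
          (a * s powr (a - 1) * exp (- \<mu> * s) - \<mu> * (s powr a * exp (- \<mu> * s)))) (at s)"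
        using s by (auto intro!: derivative_eq_intros)
      then have "(f has_vector_derivative (s powr a * exp (- \<mu> * s)) *\<^sub>R T s (G x) +
          (a * s powr (a - 1) * exp (- \<mu> * s) - \<mu> * (s powr a * exp (- \<mu> * s))) *\<^sub>R T s x) (at s)"
        unfolding f_def
        using s x by (intro has_vector_derivative_scaleR orbit_has_vector_derivative_at) auto
      then show ?thesis
        using s by (simp add: f'_def integrand_def T_diff T_scaleR algebra_simps)
    qed
  qed
  then have "integral {0..X} f' = f X" if "0 \<le> X" for X
    using that by (auto simp: f_def dest!: integral_unique)
  then have eq: "f X = a *\<^sub>R integral {0..X} (integrand a x)
      - integral {0..X} (integrand (a + 1) (\<mu> *\<^sub>R x - G x))" if "0 \<le> X" for X
    using that a unfolding f'_def
    by (simp add: integral_diff integrable_cmul integrand_integrable_Icc)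
  have "\<forall>\<^sub>F X in at_top. f X = a *\<^sub>R integral {0..X} (integrand a x)
      - integral {0..X} (integrand (a + 1) (\<mu> *\<^sub>R x - G x))"
    using eventually_ge_at_top[of 0] by eventually_elim (rule eq)
  moreover have "(f \<longlongrightarrow> 0) at_top"
    unfolding f_def using a by (intro orbit_rescaled_tendsto) simp
  ultimately have "((\<lambda>X. a *\<^sub>R integral {0..X} (integrand a x)
      - integral {0..X} (integrand (a + 1) (\<mu> *\<^sub>R x - G x))) \<longlongrightarrow> 0) at_top"
    by (rule Lim_transform_eventually[rotated])
  moreover have "((\<lambda>X. a *\<^sub>R integral {0..X} (integrand a x)
      - integral {0..X} (integrand (a + 1) (\<mu> *\<^sub>R x - G x))) \<longlongrightarrow>
      a *\<^sub>R frac a x - frac (a + 1) (\<mu> *\<^sub>R x - G x)) at_top"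
    using a by (intro tendsto_intros frac_tendsto) auto
  ultimately have "0 = a *\<^sub>R frac a x - frac (a + 1) (\<mu> *\<^sub>R x - G x)"
    by (intro tendsto_unique[OF trivial_limit_at_top_linorder])
  then show ?thesis
    by simp
qed


definition resolvent :: "'z \<Rightarrow> 'z" where "resolvent = frac 1"

lemma bounded_linear_resolvent: "bounded_linear resolvent"
  by (simp add: resolvent_def bounded_linear_frac)

text \<open>The same computation with the kernel \<open>exp (- \<mu> s)\<close> has the boundary term \<open>x\<close> at \<open>0\<close>; here the
  constant kernel \<open>s powr 0\<close> differs from \<open>1\<close> at the single point \<open>0\<close>.\<close>

lemma resolvent_left_inverse:
  assumes x: "x \<in> D"
  shows "resolvent (\<mu> *\<^sub>R x - G x) = x"
proof -
  define f where "f s = exp (- \<mu> * s) *\<^sub>R T s x" for s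
  have eq: "integral {0..X} (integrand 1 (\<mu> *\<^sub>R x - G x)) = x - f X" if "0 \<le> X" for X
  proof -
    have "((\<lambda>s. - integrand 1 (\<mu> *\<^sub>R x - G x) s) has_integral f X - f 0) {0..X}"
    proof (rule fundamental_theorem_of_calculus_interior[OF that])
      show "continuous_on {0..X} f"
        unfolding f_def by (intro continuous_intros continuous_on_T) auto
      show "(f has_vector_derivative - integrand 1 (\<mu> *\<^sub>R x - G x) s) (at s)"
        if s: "s \<in> {0<..<X}" for s
      proof -
        have "((\<lambda>s. exp (- \<mu> * s)) has_real_derivative - \<mu> * exp (- \<mu> * s)) (at s)"
          by (auto intro!: derivative_eq_intros)
        then have "(f has_vector_derivative exp (- \<mu> * s) *\<^sub>R T s (G x) +
            (- \<mu> * exp (- \<mu> * s)) *\<^sub>R T s x) (at s)"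
          unfolding f_def
          using s x by (intro has_vector_derivative_scaleR orbit_has_vector_derivative_at) auto
        then show ?thesis
          using s by (simp add: integrand_def T_diff T_scaleR algebra_simps)
      qed
    qed
    then have "integral {0..X} (\<lambda>s. - integrand 1 (\<mu> *\<^sub>R x - G x) s) = f X - f 0"
      by (rule integral_unique)
    then have "- integral {0..X} (integrand 1 (\<mu> *\<^sub>R x - G x)) = f X - x"
      by (simp add: f_def)
    then show ?thesis
      by (metis minus_diff_eq minus_minus)
  qed
  have "((\<lambda>X. (X powr 0 * exp (- \<mu> * X)) *\<^sub>R T X x) \<longlongrightarrow> 0) at_top"
    by (rule orbit_rescaled_tendsto) simp
  then have "(f \<longlongrightarrow> 0) at_top"
    by (rule Lim_transform_eventually)
      (use eventually_gt_at_top[of 0] in eventually_elim, simp add: f_def)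
  then have "((\<lambda>X. x - f X) \<longlongrightarrow> x - 0) at_top"
    by (intro tendsto_diff tendsto_const)
  moreover have "\<forall>\<^sub>F X in at_top. x - f X = integral {0..X} (integrand 1 (\<mu> *\<^sub>R x - G x))"
    using eventually_ge_at_top[of 0] by eventually_elim (simp add: eq)
  ultimately have "((\<lambda>X. integral {0..X} (integrand 1 (\<mu> *\<^sub>R x - G x))) \<longlongrightarrow> x - 0) at_top"
    by (rule Lim_transform_eventually)
  then show ?thesis
    unfolding resolvent_def
    using tendsto_unique[OF trivial_limit_at_top_linorder _ frac_tendsto[of 1]] by force
qed

text \<open>On the domain this follows from the left inverse, as the resolvent commutes with the generator;
  density of the domain and closedness of the generator give all \<open>x\<close>.\<close>

lemma resolvent_right_inverse: "resolvent x \<in> D" "G (resolvent x) = \<mu> *\<^sub>R resolvent x - x"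
proof -
  obtain u where u: "\<And>n. u n \<in> D" and lim: "u \<longlonglongrightarrow> x"
    using D_approx by blast
  have lim': "(\<lambda>n. resolvent (u n)) \<longlonglongrightarrow> resolvent x"
    using bounded_linear.tendsto[OF bounded_linear_resolvent lim] .
  have "G (resolvent (u n)) = \<mu> *\<^sub>R resolvent (u n) - u n" for n
  proof -
    have "resolvent (\<mu> *\<^sub>R u n - G (u n)) = u n"
      using resolvent_left_inverse u by blast
    then show ?thesis
      using u G_frac[of 1 "u n"] bounded_linear.linear[OF bounded_linear_resolvent]
      by (simp add: linear_diff linear_scale resolvent_def algebra_simps)
  qed
  then have "(\<lambda>n. G (resolvent (u n))) \<longlonglongrightarrow> \<mu> *\<^sub>R resolvent x - x"
    using lim lim' by (simp add: tendsto_diff tendsto_scaleR)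
  then show "resolvent x \<in> D" "G (resolvent x) = \<mu> *\<^sub>R resolvent x - x"
    using u frac_in_D[of 1] generator_closed[OF _ lim'] by (simp_all add: resolvent_def)
qed

lemma frac_resolvent:
  assumes "0 < a"
  shows "frac (a + 1) x = a *\<^sub>R frac a (resolvent x)"
  using frac_by_parts[OF assms resolvent_right_inverse(1)] by (simp add: resolvent_right_inverse)

lemma frac_of_nat: "frac (real (Suc n)) x = fact n *\<^sub>R (resolvent ^^ Suc n) x"
proof (induction n arbitrary: x)
  case (Suc n)
  have "frac (real (Suc (Suc n))) x = real (Suc n) *\<^sub>R frac (real (Suc n)) (resolvent x)"
    using frac_resolvent[of "real (Suc n)" x] by (simp add: add.commute)
  also have "\<dots> = real (Suc n) *\<^sub>R fact n *\<^sub>R (resolvent ^^ Suc n) (resolvent x)"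
    unfolding Suc.IH ..
  also have "\<dots> = fact (Suc n) *\<^sub>R (resolvent ^^ Suc (Suc n)) x"
    by (simp add: funpow_swap1 del: of_nat_Suc)
  finally show ?case .
qed (simp add: resolvent_def)

text \<open>The tail of the integral decays exponentially because half of the decay rate already makes
  it converge.\<close>

lemma frac_tail:
  assumes a: "0 < a" and X: "0 \<le> X"
  shows "norm (frac a x - integral {0..X} (integrand a x)) \<le>
    exp (- (\<epsilon> / 2) * X) * (M' * norm x * integral {0..} (\<lambda>s. s powr (a - 1) * exp (- (\<epsilon> / 2) * s)))"
    (is "_ \<le> ?bound")
proof -
  define g where "g s = (s powr (a - 1) * exp (- (\<epsilon> / 2) * s)) * (exp (- (\<epsilon> / 2) * X) * (M' * norm x))" for s
  have g_int: "g integrable_on {0..}"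
    unfolding g_def using a \<epsilon>_pos by (intro integrable_on_mult_left powr_exp_integrable) auto
  have finite_tail: "norm (integral {0..Y} (integrand a x) - integral {0..X} (integrand a x)) \<le> ?bound"
    if "X \<le> Y" for Y
  proof -
    have "integral {0..Y} (integrand a x) - integral {0..X} (integrand a x) = integral {X..Y} (integrand a x)"
      using Henstock_Kurzweil_Integration.integral_combine[of 0 X Y "integrand a x"] X that
        integrand_integrable_Icc[OF a] by (simp add: algebra_simps)
    moreover have "norm (integral {X..Y} (integrand a x)) \<le> integral {X..Y} g"
    proof (rule integral_norm_bound_integral)
      show "integrand a x integrable_on {X..Y}"
        using integrand_integrable[OF a, of x] by (rule integrable_on_subinterval) (use X in auto)
      show "g integrable_on {X..Y}"
        using g_int by (rule integrable_on_subinterval) (use X in auto)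
      show "norm (integrand a x s) \<le> g s" if s: "s \<in> {X..Y}" for s
      proof -
        have "exp (- \<epsilon> * s) \<le> exp (- (\<epsilon> / 2) * s) * exp (- (\<epsilon> / 2) * X)"
          unfolding mult_exp_exp using s \<epsilon>_pos by (simp add: field_simps)
        then have "(s powr (a - 1) * exp (- \<epsilon> * s)) * (M' * norm x) \<le>
            (s powr (a - 1) * (exp (- (\<epsilon> / 2) * s) * exp (- (\<epsilon> / 2) * X))) * (M' * norm x)"
          using M'_nonneg by (intro mult_right_mono mult_left_mono) auto
        with norm_integrand[of s a x] s X show ?thesis
          by (simp add: g_def algebra_simps)
      qed
    qed
    moreover have "integral {X..Y} g \<le> integral {0..} g"
      using g_int M'_nonneg X
      by (intro integral_subset_le integrable_on_subinterval[OF g_int]) (auto simp: g_def)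
    moreover have "integral {0..} g = ?bound"
      unfolding g_def integral_mult_left by (simp only: ac_simps)
    ultimately show ?thesis
      by (metis order_trans)
  qed
  show ?thesis
  proof (rule tendsto_upperbound[OF _ _ trivial_limit_at_top_linorder])
    show "((\<lambda>Y. norm (integral {0..Y} (integrand a x) - integral {0..X} (integrand a x))) \<longlongrightarrow>
        norm (frac a x - integral {0..X} (integrand a x))) at_top"
      using a by (intro tendsto_intros frac_tendsto)
    show "\<forall>\<^sub>F Y in at_top.
        norm (integral {0..Y} (integrand a x) - integral {0..X} (integrand a x)) \<le> ?bound"
      using eventually_ge_at_top[of X] by eventually_elim (rule finite_tail)
  qed
qed

text \<open>The semigroup law of the fractional powers. On a square \<open>{0..X} \<times> {0..X}\<close> the order of
  integration is exchanged for the kernel \<open>r powr (a - 1) * (u - r) powr (b - 1)\<close>, extended by \<open>0\<close>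
  to \<open>u < r\<close>; the kernel is then continuous because \<open>a\<close> and \<open>b\<close> exceed \<open>1\<close>. Truncating costs only the exponentially
  small tails of the inner integrals.\<close>

lemma frac_frac:
  assumes a: "1 < a" and b: "1 < b"
  shows "frac a (frac b y) = Beta a b *\<^sub>R frac (a + b) y"
proof -
  define S where "S r x = exp (- \<mu> * r) *\<^sub>R T r x" for r x
  define \<kappa> where "\<kappa> c r = max 0 r powr (c - 1)" for c r :: real
  define p where "p c X x = integral {0..X} (integrand c x)" for c X x
  have S_linear: "0 \<le> r \<Longrightarrow> bounded_linear (S r)" for r
    unfolding S_def
    by (intro bounded_linear_compose[OF bounded_linear_scaleR_right] bounded_linear_T)
  have S_add: "S (s + r) x = S r (S s x)" if "0 \<le> s" "0 \<le> r" for r s x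
  proof -
    have "exp (- \<mu> * (s + r)) = exp (- \<mu> * r) * exp (- \<mu> * s)"
      unfolding mult_exp_exp by (simp add: algebra_simps)
    then show ?thesis
      using that T_add[of r s x] by (simp add: S_def T_scaleR add.commute)
  qed
  have S_cont: "continuous_on X (\<lambda>s. S (f s) x)"
    if "continuous_on X f" "\<And>s. s \<in> X \<Longrightarrow> 0 \<le> f s" for f :: "'c::topological_space \<Rightarrow> real" and X x
    unfolding S_def by (intro continuous_intros continuous_on_T that)
  have \<kappa>_cont: "1 < c \<Longrightarrow> continuous_on X f \<Longrightarrow> continuous_on X (\<lambda>s. \<kappa> c (f s))"
    for c X and f :: "'c::topological_space \<Rightarrow> real"
    unfolding \<kappa>_def by (intro continuous_on_powr' continuous_intros) auto
  have integrand_eq: "integrand c x s = \<kappa> c s *\<^sub>R S s x" if "0 \<le> s" for c x s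
    using that by (simp add: integrand_def \<kappa>_def S_def)
  have inner: "integral {0..X} (\<lambda>u. \<kappa> b (u - r) *\<^sub>R S u y) = S r (p b (X - r) y)"
    if r: "0 \<le> r" "r \<le> X" for r X
  proof -
    have "(\<lambda>u. \<kappa> b (u - r) *\<^sub>R S u y) integrable_on {0..X}"
      using b by (intro integrable_continuous_interval continuous_intros \<kappa>_cont S_cont) auto
    then have "integral {0..X} (\<lambda>u. \<kappa> b (u - r) *\<^sub>R S u y) =
        integral {0..r} (\<lambda>u. \<kappa> b (u - r) *\<^sub>R S u y) + integral {r..X} (\<lambda>u. \<kappa> b (u - r) *\<^sub>R S u y)"
      using r by (intro Henstock_Kurzweil_Integration.integral_combine[symmetric])
    also have "integral {0..r} (\<lambda>u. \<kappa> b (u - r) *\<^sub>R S u y) = integral {0..r} (\<lambda>u. 0)"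
      by (intro integral_cong) (simp add: \<kappa>_def max_def)
    also have "integral {r..X} (\<lambda>u. \<kappa> b (u - r) *\<^sub>R S u y)
        = integral {0..X - r} (\<lambda>s. \<kappa> b s *\<^sub>R S (s + r) y)"
      using integral_shift_real_ivl[of r r X "\<lambda>u. \<kappa> b (u - r) *\<^sub>R S u y"] by simp
    also have "\<dots> = integral {0..X - r} (S r \<circ> integrand b y)"
      using r by (intro integral_cong)
        (simp add: integrand_eq S_add linear_scale[OF bounded_linear.linear[OF S_linear]])
    also have "\<dots> = S r (p b (X - r) y)"
      unfolding p_def using b r by (intro integral_linear integrand_integrable_Icc S_linear) auto
    finally show ?thesis
      by simp
  qed
  have convolution: "integral {0..X} (\<lambda>r. (\<kappa> a r * \<kappa> b (u - r)) *\<^sub>R S u y) = Beta a b *\<^sub>R integrand (a + b) y u"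
    if u: "0 \<le> u" "u \<le> X" for u X
  proof -
    have "((\<lambda>r. \<kappa> a r * \<kappa> b (u - r)) has_integral Beta a b * \<kappa> (a + b) u) {0..u}"
    proof (cases "u = 0")
      case False
      with powr_convolution_has_integral[of a b u] a b u show ?thesis
        by (auto simp: \<kappa>_def intro: has_integral_eq[rotated])
    qed (use a b in \<open>simp add: \<kappa>_def has_integral_refl\<close>)
    then have "((\<lambda>r. \<kappa> a r * \<kappa> b (u - r)) has_integral Beta a b * \<kappa> (a + b) u) {0..X}"
      by (rule has_integral_on_superset) (use u in \<open>auto simp: \<kappa>_def max_def not_le\<close>)
    then have "((\<lambda>r. (\<kappa> a r * \<kappa> b (u - r)) *\<^sub>R S u y) has_integral (Beta a b * \<kappa> (a + b) u) *\<^sub>R S u y) {0..X}"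
      by (rule has_integral_scaleR_left)
    then show ?thesis
      using u by (simp add: integral_unique integrand_eq)
  qed
  have swapped: "integral {0..X} (\<lambda>r. \<kappa> a r *\<^sub>R S r (p b (X - r) y)) = Beta a b *\<^sub>R p (a + b) X y" for X
  proof -
    have "integral {0..X} (\<lambda>r. \<kappa> a r *\<^sub>R S r (p b (X - r) y))
        = integral {0..X} (\<lambda>r. integral {0..X} (\<lambda>u. (\<kappa> a r * \<kappa> b (u - r)) *\<^sub>R S u y))"
      by (intro integral_cong) (simp add: inner[symmetric] flip: scaleR_scaleR)
    also have "\<dots> = integral {0..X} (\<lambda>u. integral {0..X} (\<lambda>r. (\<kappa> a r * \<kappa> b (u - r)) *\<^sub>R S u y))"
      using a b unfolding cbox_interval[symmetric] case_prod_unfold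
      by (intro integral_swap_continuous, unfold case_prod_unfold)
        (auto intro!: continuous_intros \<kappa>_cont S_cont simp: cbox_Pair_eq)
    also have "\<dots> = integral {0..X} (\<lambda>u. Beta a b *\<^sub>R integrand (a + b) y u)"
      by (intro integral_cong convolution) auto
    finally show ?thesis
      by (simp add: p_def)
  qed
  define c where "c = M' * norm y * integral {0..} (\<lambda>s. s powr (b - 1) * exp (- (\<epsilon> / 2) * s))"
  have error: "norm (p a X (frac b y) - Beta a b *\<^sub>R p (a + b) X y) \<le> X powr a * exp (- (\<epsilon> / 2) * X) * (M' * c)"
    if X: "0 < X" for X
  proof -
    have tail_cont: "continuous_on {0..X} (\<lambda>r. \<kappa> a r *\<^sub>R S r (p b (X - r) y))"
    proof -
      have "continuous_on {0..X} (\<lambda>v. p b v y)"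
        unfolding p_def using b by (intro indefinite_integral_continuous_1 integrand_integrable_Icc) auto
      then have "continuous_on {0..X} (\<lambda>r. p b (X - r) y)"
        by (rule continuous_on_compose2) (auto intro!: continuous_intros)
      then show ?thesis
        unfolding S_def using a by (intro continuous_intros \<kappa>_cont continuous_on_T) auto
    qed
    have head_cont: "continuous_on {0..X} (\<lambda>r. \<kappa> a r *\<^sub>R S r (frac b y))"
      using a by (intro continuous_intros \<kappa>_cont S_cont) auto
    have "p a X (frac b y) = integral {0..X} (\<lambda>r. \<kappa> a r *\<^sub>R S r (frac b y))"
      unfolding p_def by (intro integral_cong) (simp add: integrand_eq)
    then have "p a X (frac b y) - Beta a b *\<^sub>R p (a + b) X y =
        integral {0..X} (\<lambda>r. \<kappa> a r *\<^sub>R S r (frac b y) - \<kappa> a r *\<^sub>R S r (p b (X - r) y))"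
      unfolding swapped[symmetric]
      by (simp add: integral_diff integrable_continuous_interval tail_cont head_cont)
    also have "norm \<dots> \<le> (X powr (a - 1) * (exp (- (\<epsilon> / 2) * X) * (M' * c))) * (X - 0)"
    proof (rule integral_bound)
      fix r assume r: "r \<in> {0..X}"
      \<comment> \<open>Half of the rate suffices on \<open>{0..r}\<close>, to match the rate of the tail on the remaining \<open>X - r\<close>.\<close>
      have "norm (S r (frac b y - p b (X - r) y)) \<le> M' * exp (- \<epsilon> * r) * norm (frac b y - p b (X - r) y)"
        unfolding S_def using r by (intro norm_rescaled) auto
      also have "\<dots> \<le> M' * exp (- (\<epsilon> / 2) * r) * (exp (- (\<epsilon> / 2) * (X - r)) * c)"
        using frac_tail[of b "X - r" y] r b \<epsilon>_pos M'_nonneg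
        by (intro mult_mono mult_left_mono) (auto simp: p_def c_def)
      also have "\<dots> = exp (- (\<epsilon> / 2) * r + - (\<epsilon> / 2) * (X - r)) * (M' * c)"
        unfolding exp_add by (simp only: ac_simps)
      also have "- (\<epsilon> / 2) * r + - (\<epsilon> / 2) * (X - r) = - (\<epsilon> / 2) * X"
        by (simp add: algebra_simps)
      finally have "norm (S r (frac b y - p b (X - r) y)) \<le> exp (- (\<epsilon> / 2) * X) * (M' * c)" .
      moreover have "\<kappa> a r \<le> X powr (a - 1)" "0 \<le> \<kappa> a r"
        unfolding \<kappa>_def using r a by (auto intro!: powr_mono2)
      ultimately have "\<kappa> a r * norm (S r (frac b y - p b (X - r) y))
          \<le> X powr (a - 1) * (exp (- (\<epsilon> / 2) * X) * (M' * c))"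
        by (intro mult_mono) auto
      then show "norm (\<kappa> a r *\<^sub>R S r (frac b y) - \<kappa> a r *\<^sub>R S r (p b (X - r) y))
          \<le> X powr (a - 1) * (exp (- (\<epsilon> / 2) * X) * (M' * c))"
        using r \<open>0 \<le> \<kappa> a r\<close>
        by (simp add: linear_diff[OF bounded_linear.linear[OF S_linear]] flip: scaleR_diff_right)
    qed (use X in \<open>auto intro!: continuous_on_diff head_cont tail_cont\<close>)
    also have "\<dots> = X powr a * exp (- (\<epsilon> / 2) * X) * (M' * c)"
      using X powr_mult_base[of X "a - 1"] by (simp add: ac_simps)
    finally show ?thesis .
  qed
  have "((\<lambda>X. p a X (frac b y) - Beta a b *\<^sub>R p (a + b) X y) \<longlongrightarrow> 0) at_top"
  proof (rule Lim_null_comparison)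
    show "\<forall>\<^sub>F X in at_top. norm (p a X (frac b y) - Beta a b *\<^sub>R p (a + b) X y)
        \<le> X powr a * exp (- (\<epsilon> / 2) * X) * (M' * c)"
      using eventually_gt_at_top[of 0] by eventually_elim (rule error)
    have "((\<lambda>X. X powr a * exp (- (\<epsilon> / 2) * X)) \<longlongrightarrow> 0) at_top"
      using \<epsilon>_pos by real_asymp
    then show "((\<lambda>X. X powr a * exp (- (\<epsilon> / 2) * X) * (M' * c)) \<longlongrightarrow> 0) at_top"
      by (rule tendsto_mult_left_zero)
  qed
  moreover have "((\<lambda>X. p a X (frac b y) - Beta a b *\<^sub>R p (a + b) X y) \<longlongrightarrow>
      frac a (frac b y) - Beta a b *\<^sub>R frac (a + b) y) at_top"
    unfolding p_def using a b by (intro tendsto_intros frac_tendsto) auto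
  ultimately have "frac a (frac b y) - Beta a b *\<^sub>R frac (a + b) y = 0"
    by (intro tendsto_unique[OF trivial_limit_at_top_linorder])
  then show ?thesis
    by simp
qed

end

section \<open>Polynomial stability makes the generator invertible\<close>

lemma small_perturbation_surj:
  fixes E :: "'a::banach \<Rightarrow> 'a"
  assumes "linear E" and E: "\<And>x. norm (E x) \<le> (1 / 2) * norm x"
  obtains x where "x - E x = y" "norm x \<le> 2 * norm y"
proof -
  have "\<exists>!x. y + E x = x"
  proof (rule banach_fix_type[where c = "1 / 2"])
    show "\<forall>x x'. dist (y + E x) (y + E x') \<le> 1 / 2 * dist x x'"
      using E linear_diff[OF assms(1)] by (metis dist_add_cancel dist_norm)
  qed auto
  then obtain x where x: "y + E x = x"
    by blast
  have "norm x \<le> norm y + norm (E x)"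
    using x norm_triangle_ineq by metis
  then show thesis
    using that[of x] x E[of x] by (simp add: algebra_simps)
qed

context bounded_C0_semigroup
begin

text \<open>A Landau type inequality, from the first order Taylor expansion of the orbit at time \<open>0\<close>.\<close>

lemma landau_inequality:
  assumes x: "x \<in> D" and Gx: "G x \<in> D" and s: "0 \<le> s"
  shows "s * norm (G x) \<le> (M + 1) * norm x + s * (s * (M * norm (G (G x))))"
proof -
  have "((\<lambda>r. T r (G x) - G x) has_integral (T s x - x - s *\<^sub>R G x)) {0..s}"
    using has_integral_diff[OF orbit_increment_has_integral[OF x s]
        has_integral_const_real[of "G x" 0 s]] s by simp
  then have "integral {0..s} (\<lambda>r. T r (G x) - G x) = T s x - x - s *\<^sub>R G x"
    by (rule integral_unique)
  moreover have "norm (integral {0..s} (\<lambda>r. T r (G x) - G x)) \<le> (s * (M * norm (G (G x)))) * (s - 0)"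
  proof (rule integral_bound[OF s])
    show "continuous_on {0..s} (\<lambda>r. T r (G x) - G x)"
      by (intro continuous_intros continuous_on_T) auto
    fix r assume r: "r \<in> {0..s}"
    have "norm (T r (G x) - G x) \<le> r * (M * norm (G (G x)))"
      using r by (intro norm_orbit_increment Gx) auto
    also have "\<dots> \<le> s * (M * norm (G (G x)))"
      using r M_nonneg by (intro mult_right_mono) auto
    finally show "norm (T r (G x) - G x) \<le> s * (M * norm (G (G x)))" .
  qed
  ultimately have "norm (T s x - x - s *\<^sub>R G x) \<le> s * (s * (M * norm (G (G x))))"
    by (simp add: mult.commute)
  moreover have "norm (s *\<^sub>R G x) \<le> norm (T s x) + norm x + norm (T s x - x - s *\<^sub>R G x)"
    using norm_triangle_ineq4[of "T s x - x" "T s x - x - s *\<^sub>R G x"] norm_triangle_ineq4[of "T s x" x]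
    by simp
  moreover have "norm (T s x) \<le> M * norm x"
    using s by (rule norm_T)
  ultimately have "norm (s *\<^sub>R G x) \<le> M * norm x + norm x + s * (s * (M * norm (G (G x))))"
    by linarith
  then show ?thesis
    using s by (simp add: distrib_right)
qed

end

context rescaled_semigroup
begin

lemma bounded_linear_resolvent_power: "bounded_linear (resolvent ^^ k)"
proof (induction k)
  case (Suc k)
  then show ?case
    using bounded_linear_compose[OF bounded_linear_resolvent Suc] by (simp add: o_def)
qed (simp add: id_def)

text \<open>Interpolation: halving the decay rate lowers the power of the resolvent by one. The
  inequality \<open>landau_inequality\<close>, with \<open>s = t powr (- \<gamma> / 2)\<close>, balances the decaying \<open>x = T t (resolvent^(k+2) y)\<close> against
  the bounded \<open>G (G x)\<close>.\<close>

lemma resolvent_power_decay_step: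
  assumes N: "0 \<le> N" and \<gamma>: "0 < \<gamma>"
    and decay: "\<And>t y. 0 < t \<Longrightarrow> norm (T t ((resolvent ^^ Suc (Suc k)) y)) \<le> N * t powr - \<gamma> * norm y"
  shows "\<exists>N'\<ge>0. \<forall>t>0. \<forall>y. norm (T t ((resolvent ^^ Suc k) y)) \<le> N' * t powr - (\<gamma> / 2) * norm y"
proof -
  define E where "E y = \<mu> *\<^sub>R (\<mu> *\<^sub>R (resolvent ^^ Suc (Suc k)) y - (resolvent ^^ Suc k) y)
    - (\<mu> *\<^sub>R (resolvent ^^ Suc k) y - (resolvent ^^ k) y)" for y
  have "bounded_linear E"
    unfolding E_def
    by (intro bounded_linear_sub bounded_linear_compose[OF bounded_linear_scaleR_right]
        bounded_linear_resolvent_power)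
  then obtain KE where KE: "0 \<le> KE" "\<And>y. norm (E y) \<le> norm y * KE"
    using bounded_linear.nonneg_bounded by blast
  obtain KR where KR: "0 \<le> KR" "\<And>y. norm ((resolvent ^^ Suc k) y) \<le> norm y * KR"
    using bounded_linear.nonneg_bounded[OF bounded_linear_resolvent_power] by blast
  define N' where "N' = M * KR + ((M + 1) * N + M * (M * KE) + \<bar>\<mu>\<bar> * N)"
  have "norm (T t ((resolvent ^^ Suc k) y)) \<le> N' * t powr - (\<gamma> / 2) * norm y" if t: "0 < t" for t y
  proof (cases "t \<le> 1")
    case True
    have "norm (T t ((resolvent ^^ Suc k) y)) \<le> M * (norm y * KR)"
      using norm_T[of t] t KR(2)[of y] M_nonneg by (meson order_trans mult_left_mono less_imp_le)
    also have "\<dots> \<le> N' * norm y"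
      using M_nonneg N KE KR by (simp add: N'_def algebra_simps mult_right_mono)
    also have "\<dots> \<le> N' * t powr - (\<gamma> / 2) * norm y"
    proof -
      have "1 \<le> t powr - (\<gamma> / 2)"
        using True t \<gamma> powr_mono2'[of "\<gamma> / 2" t 1] by (simp add: powr_minus field_simps powr_le1)
      moreover have "0 \<le> N'"
        using M_nonneg N KE KR by (simp add: N'_def)
      ultimately show ?thesis
        using mult_left_mono[of 1 "t powr - (\<gamma> / 2)" N'] by (intro mult_right_mono) auto
    qed
    finally show ?thesis .
  next
    case False
    define s where "s = t powr - (\<gamma> / 2)"
    have s: "0 < s" "s \<le> 1"
      using t False \<gamma> by (auto simp: s_def powr_minus intro!: inverse_le_1_iff[THEN iffD2] ge_one_powr_ge_zero)
    have ss: "t powr - \<gamma> = s * s"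
      by (simp add: s_def flip: powr_add)
    define z where "z = (resolvent ^^ Suc (Suc k)) y"
    define v where "v = (resolvent ^^ Suc k) y"
    define w where "w = (resolvent ^^ k) y"
    have z: "z \<in> D" "G z = \<mu> *\<^sub>R z - v" and v: "v \<in> D" "G v = \<mu> *\<^sub>R v - w"
      by (simp_all add: z_def v_def w_def resolvent_right_inverse)
    have Gz: "G z \<in> D" "G (G z) = E y"
      using z v G_diff[of "\<mu> *\<^sub>R z" v] G_scaleR[of z \<mu>]
      by (simp_all add: E_def z_def[symmetric] v_def[symmetric] w_def[symmetric] del: funpow.simps)
    have "s * norm (G (T t z)) \<le> (M + 1) * norm (T t z) + s * (s * (M * norm (G (G (T t z)))))"
      using t s z(1) Gz(1) by (intro landau_inequality) (simp_all add: T_in_D G_T)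
    also have "G (G (T t z)) = T t (E y)"
      using t z(1) Gz by (simp add: G_T)
    also have "(M + 1) * norm (T t z) + s * (s * (M * norm (T t (E y))))
        \<le> (M + 1) * (N * (s * s) * norm y) + s * (s * (M * (M * (norm y * KE))))"
    proof (intro add_mono mult_left_mono)
      show "norm (T t z) \<le> N * (s * s) * norm y"
        using decay[OF t, of y] by (simp only: z_def ss)
      show "norm (T t (E y)) \<le> M * (norm y * KE)"
        using t by (intro order_trans[OF norm_T mult_left_mono[OF KE(2)]] M_nonneg) simp
    qed (use s M_nonneg in auto)
    also have "\<dots> = s * (s * ((M + 1) * N + M * (M * KE)) * norm y)"
      by (simp add: algebra_simps)
    finally have Gest: "norm (G (T t z)) \<le> s * ((M + 1) * N + M * (M * KE)) * norm y"
      using s by (simp add: mult_le_cancel_left)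
    have "norm (T t z) \<le> N * (s * s) * norm y"
      using decay[OF t, of y] by (simp only: z_def ss)
    also have "\<dots> \<le> N * (s * 1) * norm y"
      using s N by (intro mult_right_mono mult_left_mono) auto
    finally have zest: "\<bar>\<mu>\<bar> * norm (T t z) \<le> \<bar>\<mu>\<bar> * (N * s * norm y)"
      by (intro mult_left_mono) auto
    have "T t v = \<mu> *\<^sub>R T t z - G (T t z)"
      using t z by (simp add: G_T T_diff T_scaleR)
    then have "norm (T t v) \<le> \<bar>\<mu>\<bar> * norm (T t z) + norm (G (T t z))"
      by (metis norm_triangle_ineq4 norm_scaleR)
    also have "\<dots> \<le> \<bar>\<mu>\<bar> * (N * s * norm y) + s * ((M + 1) * N + M * (M * KE)) * norm y"
      using Gest zest by linarith
    also have "\<dots> = ((M + 1) * N + M * (M * KE) + \<bar>\<mu>\<bar> * N) * s * norm y"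
      by (simp add: algebra_simps)
    also have "\<dots> \<le> N' * s * norm y"
      unfolding N'_def using s M_nonneg KR by (intro mult_right_mono) auto
    finally show ?thesis
      by (simp add: v_def s_def)
  qed
  moreover have "0 \<le> N'"
    using M_nonneg N KE KR by (simp add: N'_def)
  ultimately show ?thesis
    by blast
qed

lemma resolvent_decay_from_power:
  assumes "0 \<le> N" "0 < \<gamma>"
    and "\<And>t y. 0 < t \<Longrightarrow> norm (T t ((resolvent ^^ Suc k) y)) \<le> N * t powr - \<gamma> * norm y"
  shows "\<exists>N\<ge>0. \<exists>\<gamma>>0. \<forall>t>0. \<forall>y. norm (T t (resolvent y)) \<le> N * t powr - \<gamma> * norm y"
  using assms
proof (induction k arbitrary: N \<gamma>)
  case (Suc k)
  then obtain N' where "0 \<le> N'"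
    "\<And>t y. 0 < t \<Longrightarrow> norm (T t ((resolvent ^^ Suc k) y)) \<le> N' * t powr - (\<gamma> / 2) * norm y"
    using resolvent_power_decay_step[of N \<gamma> k] by metis
  then show ?case
    using Suc.prems(2) by (intro Suc.IH[of N' "\<gamma> / 2"]) auto
next
  case 0
  then show ?case
    by (intro exI[of _ N] exI[of _ \<gamma>] conjI) simp_all
qed

text \<open>A fractional power that decays is, up to a bounded factor, below an integral power of the
  resolvent, which therefore decays at the same rate.\<close>

lemma resolvent_decay:
  assumes a: "0 < a" and N: "0 \<le> N" and \<beta>: "0 < \<beta>"
    and decay: "\<And>t y. 0 < t \<Longrightarrow> norm (T t (frac a y)) \<le> N * t powr - \<beta> * norm y"
  shows "\<exists>N\<ge>0. \<exists>\<gamma>>0. \<forall>t>0. \<forall>y. norm (T t (resolvent y)) \<le> N * t powr - \<gamma> * norm y"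
proof -
  \<comment> \<open>The semigroup law requires exponents above \<open>1\<close>: \<open>a\<close> is raised to \<open>a + 1\<close>, and the complement \<open>b\<close> to
    the integer \<open>n + 1\<close> exceeds \<open>1\<close> for large \<open>n\<close>.\<close>
  obtain n where n: "a + 2 < real n"
    using reals_Archimedean2 by blast
  define b where "b = real (Suc n) - (a + 1)"
  have b: "1 < b"
    using n by (simp add: b_def)
  define c where "c = Beta (a + 1) b * fact n"
  have c: "0 < c"
    using a b by (simp add: c_def Beta_def Gamma_real_pos)
  have "bounded_linear (\<lambda>y. resolvent (frac b y))"
    using b by (intro bounded_linear_compose[OF bounded_linear_resolvent] bounded_linear_frac) simp
  then obtain k where k: "0 \<le> k" "\<And>y. norm (resolvent (frac b y)) \<le> norm y * k"
    using bounded_linear.nonneg_bounded by blast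
  have "norm (T t ((resolvent ^^ Suc n) y)) \<le> (a * N * k / c) * t powr - \<beta> * norm y" if t: "0 < t" for t y
  proof -
    have "c *\<^sub>R (resolvent ^^ Suc n) y = Beta (a + 1) b *\<^sub>R frac (a + 1 + b) y"
      using frac_of_nat[of n y] by (simp add: c_def b_def)
    also have "\<dots> = frac (a + 1) (frac b y)"
      using a b by (simp add: frac_frac)
    also have "\<dots> = a *\<^sub>R frac a (resolvent (frac b y))"
      using a by (rule frac_resolvent)
    finally have "c *\<^sub>R T t ((resolvent ^^ Suc n) y) = a *\<^sub>R T t (frac a (resolvent (frac b y)))"
      using t by (metis T_scaleR less_imp_le)
    then have "c * norm (T t ((resolvent ^^ Suc n) y)) = a * norm (T t (frac a (resolvent (frac b y))))"
      using a c by (metis norm_scaleR abs_of_pos)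
    also have "\<dots> \<le> a * (N * t powr - \<beta> * (norm y * k))"
      using order_trans[OF decay[OF t] mult_left_mono[OF k(2)]] N a by (intro mult_left_mono) auto
    finally show ?thesis
      using c by (simp add: field_simps)
  qed
  then show ?thesis
    using a N k c \<beta> by (intro resolvent_decay_from_power[of "a * N * k / c" \<beta> n]) auto
qed

text \<open>Once \<open>\<mu> T t resolvent\<close> has norm at most \<open>1/2\<close>, the identity differs from it by an operator that
  factors through the generator,
  \<open>x - \<mu> T t (resolvent x) = G (- resolvent x - \<mu> (integral of T s (resolvent x) over {0..t}))\<close>,
  and the left hand side is invertible by a Neumann series. Hence the generator is surjective with a
  bounded section. A vector \<open>x\<close> in its kernel is fixed by the semigroup and by \<open>\<mu> resolvent\<close>, hence by
  \<open>\<mu> T t resolvent\<close>, and a contraction fixes only \<open>0\<close>.\<close>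

lemma generator_invertible:
  assumes N: "0 \<le> N" and \<gamma>: "0 < \<gamma>"
    and decay: "\<And>t y. 0 < t \<Longrightarrow> norm (T t (resolvent y)) \<le> N * t powr - \<gamma> * norm y"
  shows "\<exists>\<alpha>. decay_exponent D G T \<alpha>"
proof -
  have "((\<lambda>t. \<bar>\<mu>\<bar> * (N * t powr - \<gamma>)) \<longlongrightarrow> 0) at_top"
    using \<gamma> by real_asymp
  then have "\<forall>\<^sub>F t in at_top. \<bar>\<mu>\<bar> * (N * t powr - \<gamma>) < 1 / 2"
    by (rule order_tendstoD) simp
  then have "\<exists>t>0. \<bar>\<mu>\<bar> * (N * t powr - \<gamma>) < 1 / 2"
    using eventually_happens'[OF trivial_limit_at_top_linorder eventually_conj[OF _ eventually_gt_at_top[of 0]]]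
    by blast
  then obtain t where t: "0 < t" and small: "\<bar>\<mu>\<bar> * (N * t powr - \<gamma>) < 1 / 2"
    by blast
  define E where "E x = \<mu> *\<^sub>R T t (resolvent x)" for x
  have E_linear: "linear E"
    unfolding E_def using t
    by (intro bounded_linear.linear bounded_linear_compose[OF bounded_linear_scaleR_right]
        bounded_linear_compose[OF bounded_linear_T] bounded_linear_resolvent) simp
  have E: "norm (E x) \<le> (1 / 2) * norm x" for x
  proof -
    have "norm (E x) \<le> \<bar>\<mu>\<bar> * (N * t powr - \<gamma> * norm x)"
      unfolding E_def using decay[OF t, of x] by (simp add: mult_left_mono)
    also have "\<dots> = (\<bar>\<mu>\<bar> * (N * t powr - \<gamma>)) * norm x"
      by simp
    also have "\<dots> \<le> (1 / 2) * norm x"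
      using small by (intro mult_right_mono) auto
    finally show ?thesis .
  qed
  define V where "V x = - resolvent x - \<mu> *\<^sub>R integral {0..t} (\<lambda>s. T s (resolvent x))" for x
  have GV: "V x \<in> D" "G (V x) = x - E x" for x
  proof -
    have "G (V x) = - (\<mu> *\<^sub>R resolvent x - x) - \<mu> *\<^sub>R (T t (resolvent x) - resolvent x)"
      and "V x \<in> D"
      unfolding V_def using t
      by (simp_all add: G_diff G_minus G_scaleR integral_orbit_in_D resolvent_right_inverse)
    then show "V x \<in> D" "G (V x) = x - E x"
      by (simp_all add: E_def algebra_simps)
  qed
  obtain KR where KR: "0 \<le> KR" "\<And>x. norm (resolvent x) \<le> norm x * KR"
    using bounded_linear.nonneg_bounded[OF bounded_linear_resolvent] by blast
  have norm_V: "norm (V x) \<le> (KR + \<bar>\<mu>\<bar> * (M * KR * t)) * norm x" for x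
  proof -
    have "norm (integral {0..t} (\<lambda>s. T s (resolvent x))) \<le> M * (norm x * KR) * (t - 0)"
      using t KR(2)[of x] M_nonneg
      by (intro integral_bound continuous_on_T continuous_intros)
        (auto intro: order_trans[OF norm_T] mult_left_mono)
    then have "\<bar>\<mu>\<bar> * norm (integral {0..t} (\<lambda>s. T s (resolvent x))) \<le> \<bar>\<mu>\<bar> * (M * (norm x * KR) * t)"
      by (intro mult_left_mono) auto
    moreover have "norm (V x) \<le> norm (resolvent x) + \<bar>\<mu>\<bar> * norm (integral {0..t} (\<lambda>s. T s (resolvent x)))"
      unfolding V_def by (metis norm_triangle_ineq4 norm_minus_cancel norm_scaleR)
    ultimately show ?thesis
      using KR(2)[of x] by (simp add: algebra_simps)
  qed
  have ker: "x = 0" if x: "x \<in> D" "G x = 0" for x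
  proof -
    have "T t x = x"
      using norm_orbit_increment[OF x(1), of t] x(2) t by simp
    moreover have "x = \<mu> *\<^sub>R resolvent x"
      using resolvent_left_inverse[OF x(1)] x(2) linear_scale[OF bounded_linear.linear[OF bounded_linear_resolvent]]
      by simp
    ultimately have "E x = x"
      unfolding E_def using t by (metis T_scaleR less_imp_le)
    then show ?thesis
      using E[of x] by simp
  qed
  have inj: "inj_on G D"
  proof (rule inj_onI)
    fix x y assume xy: "x \<in> D" "y \<in> D" "G x = G y"
    then show "x = y"
      using ker[of "x - y"] G_diff[of x y] by simp
  qed
  have section_exists: "\<exists>x\<in>D. G x = y \<and> norm x \<le> norm y * (2 * (KR + \<bar>\<mu>\<bar> * (M * KR * t)))" for y
  proof -
    obtain x where x: "x - E x = y" "norm x \<le> 2 * norm y"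
      using small_perturbation_surj[OF E_linear E] by blast
    have "norm (V x) \<le> (KR + \<bar>\<mu>\<bar> * (M * KR * t)) * (2 * norm y)"
      using order_trans[OF norm_V mult_left_mono[OF x(2)]] KR(1) M_nonneg t by simp
    then show ?thesis
      using GV[of x] x(1) by (intro bexI[of _ "V x"]) (auto simp: algebra_simps)
  qed
  have bij: "bij_betw G D UNIV"
    using inj section_exists by (auto simp: bij_betw_def image_iff) metis
  define H where "H = inv_into D G"
  have H: "H y \<in> D" "G (H y) = y" for y
    unfolding H_def using bij by (simp_all add: bij_betw_def f_inv_into_f inv_into_into)
  have H_unique: "H y = x" if "x \<in> D" "G x = y" for x y
    using H[of y] that inj by (metis inj_onD)
  have norm_H: "norm (H y) \<le> norm y * (2 * (KR + \<bar>\<mu>\<bar> * (M * KR * t)))" for y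
    using section_exists[of y] H_unique by metis
  have "bounded_linear H"
  proof (rule bounded_linear_intro)
    show "H (x + y) = H x + H y" "H (r *\<^sub>R x) = r *\<^sub>R H x" for x y r
      by (intro H_unique; simp add: G_add G_scaleR H)+
  qed (rule norm_H)
  moreover have "H (c *\<^sub>C x) = c *\<^sub>C H x" for c x
    by (intro H_unique; simp add: G_scaleC H)
  ultimately have inv: "boundedly_invertible D G"
    using bij by (simp add: boundedly_invertible_def bounded_clinear_def H_def)
  define k where "k = \<bar>\<mu>\<bar> * (2 * (KR + \<bar>\<mu>\<bar> * (M * KR * t))) + 1"
  have k: "0 < k"
    using KR(1) M_nonneg t by (simp add: k_def add_nonneg_pos)
  have "norm (T u (H y)) \<le> (N + 1) * k * u powr - \<gamma> * norm y" if u: "0 < u" for u y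
  proof -
    have "H y = resolvent (\<mu> *\<^sub>R H y - y)"
      using resolvent_left_inverse[OF H(1)] H(2) by metis
    then have "norm (T u (H y)) \<le> N * u powr - \<gamma> * norm (\<mu> *\<^sub>R H y - y)"
      using decay[OF u] by metis
    also have "\<dots> \<le> (N + 1) * u powr - \<gamma> * (k * norm y)"
    proof (intro mult_mono)
      have "norm (\<mu> *\<^sub>R H y - y) \<le> \<bar>\<mu>\<bar> * norm (H y) + norm y"
        by (metis norm_triangle_ineq4 norm_scaleR)
      also have "\<dots> \<le> \<bar>\<mu>\<bar> * (norm y * (2 * (KR + \<bar>\<mu>\<bar> * (M * KR * t)))) + norm y"
        using norm_H[of y] by (intro add_mono mult_left_mono) auto
      finally show "norm (\<mu> *\<^sub>R H y - y) \<le> k * norm y"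
        by (simp add: k_def algebra_simps)
    qed (use N in auto)
    finally show ?thesis
      by (simp add: ac_simps)
  qed
  then have "onorm (\<lambda>y. T u (H y)) \<le> (N + 1) * k * u powr - \<gamma>" if "0 < u" for u
    using that N k by (intro onorm_bound) auto
  then show ?thesis
    using inv \<gamma> N k
    by (intro exI[of _ "1 / \<gamma>"])
      (auto simp: decay_exponent_def H_def intro!: exI[of _ "(N + 1) * k"])
qed

end

context bounded_C0_semigroup
begin

text \<open>The exponent obtained here need not be optimal: every interpolation step halves the rate.\<close>

lemma polynomially_stable_decay_exponent:
  assumes "polynomially_stable T"
  shows "\<exists>\<alpha>. decay_exponent D G T \<alpha>"
proof -
  obtain \<mu> M' \<epsilon> a \<beta> N where M': "0 < M'" and \<epsilon>: "0 < \<epsilon>"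
    and growth: "\<And>t. 0 \<le> t \<Longrightarrow> onorm (T t) \<le> M' * exp ((\<mu> - \<epsilon>) * t)"
    and a: "0 < a" and \<beta>: "0 < \<beta>" and N: "0 < N"
    and decay: "\<And>t. 0 < t \<Longrightarrow> onorm (\<lambda>x. T t (neg_frac_power T \<mu> a x)) \<le> N * t powr - \<beta>"
    using assms unfolding polynomially_stable_def growth_below_def by metis
  interpret rescaled_semigroup D G T M \<mu> \<epsilon> M'
  proof
    show "norm (T t x) \<le> M' * exp ((\<mu> - \<epsilon>) * t) * norm x" if "0 \<le> t" for t x
      using onorm[OF bounded_linear_T[OF that], of x] growth[OF that]
      by (meson mult_right_mono norm_ge_zero order_trans)
  qed (use M' \<epsilon> in auto)
  have "norm (T t (frac a y)) \<le> (Gamma a * N) * t powr - \<beta> * norm y" if t: "0 < t" for t y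
  proof -
    have "bounded_linear (\<lambda>x. T t (neg_frac_power T \<mu> a x))"
      unfolding neg_frac_power_eq using t a
      by (intro bounded_linear_compose[OF bounded_linear_T]
          bounded_linear_compose[OF bounded_linear_scaleR_right] bounded_linear_frac) auto
    then have "norm (T t (neg_frac_power T \<mu> a y)) \<le> N * t powr - \<beta> * norm y"
      using onorm decay[OF t] by (meson mult_right_mono norm_ge_zero order_trans)
    then have "norm (T t (frac a y)) / Gamma a \<le> N * t powr - \<beta> * norm y"
      using t Gamma_real_pos[OF a] by (simp add: neg_frac_power_eq T_scaleR)
    then show ?thesis
      using Gamma_real_pos[OF a] by (simp add: field_simps)
  qed
  with a \<beta> have "\<exists>N\<ge>0. \<exists>\<gamma>>0. \<forall>t>0. \<forall>y. norm (T t (resolvent y)) \<le> N * t powr - \<gamma> * norm y"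
    using N Gamma_real_pos[OF a] by (intro resolvent_decay[of a "Gamma a * N" \<beta>]) auto
  then show ?thesis
    using generator_invertible by blast
qed

lemma decay_on_domain:
  assumes "decay_exponent D G T \<alpha>"
  obtains N where "0 < N" "\<And>x t. x \<in> D \<Longrightarrow> 0 < t \<Longrightarrow> norm (T t x) \<le> N * t powr (- 1 / \<alpha>) * norm (G x)"
proof -
  obtain N where N: "0 < N"
    and onorm_le: "\<And>t. 0 < t \<Longrightarrow> onorm (\<lambda>x. T t (inv_into D G x)) \<le> N * t powr (- 1 / \<alpha>)"
    and bij: "bij_betw G D UNIV" and blin: "bounded_linear (inv_into D G)"
    using assms unfolding decay_exponent_def boundedly_invertible_def bounded_clinear_def by blast
  have "norm (T t x) \<le> N * t powr (- 1 / \<alpha>) * norm (G x)" if x: "x \<in> D" and t: "0 < t" for x t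
  proof -
    have "inv_into D G (G x) = x"
      using bij x by (simp add: bij_betw_def)
    moreover have "bounded_linear (\<lambda>x. T t (inv_into D G x))"
      using t by (intro bounded_linear_compose[OF bounded_linear_T] blin) simp
    ultimately have "norm (T t x) \<le> onorm (\<lambda>x. T t (inv_into D G x)) * norm (G x)"
      using onorm[of "\<lambda>x. T t (inv_into D G x)" "G x"] by simp
    also have "\<dots> \<le> N * t powr (- 1 / \<alpha>) * norm (G x)"
      using onorm_le[OF t] by (intro mult_right_mono) auto
    finally show ?thesis .
  qed
  with N show thesis
    by (rule that)
qed

lemma decay_tendsto_0:
  assumes "decay_exponent D G T \<alpha>"
  shows "((\<lambda>t. t powr (- 1 / \<alpha>)) \<longlongrightarrow> 0) at_top"
proof -
  have "0 < \<alpha>"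
    using assms by (simp add: decay_exponent_def)
  then show ?thesis
    by real_asymp
qed

text \<open>The decay on the dense domain extends to all vectors by boundedness of the semigroup.\<close>

lemma strongly_stable:
  assumes "decay_exponent D G T \<alpha>"
  shows "((\<lambda>t. T t x) \<longlongrightarrow> 0) at_top"
proof (rule tendstoI)
  fix e :: real assume e: "0 < e"
  obtain N where N: "\<And>x t. x \<in> D \<Longrightarrow> 0 < t \<Longrightarrow> norm (T t x) \<le> N * t powr (- 1 / \<alpha>) * norm (G x)"
    using decay_on_domain[OF assms] by metis
  obtain u where u: "\<And>n. u n \<in> D" "u \<longlonglongrightarrow> x"
    using D_approx by blast
  have "0 < e / (2 * (M + 1))"
    using e M_nonneg by simp
  then obtain n where n: "dist (u n) x < e / (2 * (M + 1))"
    using metric_LIMSEQ_D[OF u(2)] by blast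
  have near: "norm (T t (x - u n)) \<le> e / 2" if "0 \<le> t" for t
  proof -
    have "norm (T t (x - u n)) \<le> (M + 1) * norm (x - u n)"
      using norm_T[OF that, of "x - u n"] by (simp add: algebra_simps add_increasing)
    also have "\<dots> \<le> (M + 1) * (e / (2 * (M + 1)))"
      using n M_nonneg by (intro mult_left_mono) (auto simp: dist_norm norm_minus_commute)
    also have "\<dots> = e / 2"
      using M_nonneg by (simp add: field_simps)
    finally show ?thesis .
  qed
  have "((\<lambda>t. N * t powr (- 1 / \<alpha>) * norm (G (u n))) \<longlongrightarrow> N * 0 * norm (G (u n))) at_top"
    by (intro tendsto_intros decay_tendsto_0[OF assms])
  then have "\<forall>\<^sub>F t in at_top. N * t powr (- 1 / \<alpha>) * norm (G (u n)) < e / 2"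
    by (rule order_tendstoD) (use e in simp)
  then show "\<forall>\<^sub>F t in at_top. dist (T t x) 0 < e"
    using eventually_gt_at_top[of 0]
  proof eventually_elim
    case (elim t)
    have "T t x = T t (u n) + T t (x - u n)"
      using elim by (simp add: T_diff)
    then have "norm (T t x) \<le> norm (T t (u n)) + norm (T t (x - u n))"
      using norm_triangle_ineq by metis
    then show ?case
      using elim near[of t] N[OF u(1)[of n], of t] by simp
  qed
qed

end

section \<open>The exosystem\<close>

locale isometric_C0_group =
  fixes D :: "'w::complex_banach set" and S :: "'w \<Rightarrow> 'w" and U :: "real \<Rightarrow> 'w \<Rightarrow> 'w"
  assumes generates: "generates_group D S U" and isometric: "isometric_group U"
begin

lemma bounded_clinear_U: "bounded_clinear (U t)"
  and U_zero [simp]: "U 0 w = w"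
  and U_add: "U (s + t) w = U s (U t w)"
  and U_tendsto: "((\<lambda>t. U t w) \<longlongrightarrow> w) (at 0)"
  and D_iff_quotient: "w \<in> D \<longleftrightarrow> (\<exists>v. ((\<lambda>h. (U h w - w) /\<^sub>R h) \<longlongrightarrow> v) (at 0))"
  and S_tendsto: "w \<in> D \<Longrightarrow> ((\<lambda>h. (U h w - w) /\<^sub>R h) \<longlongrightarrow> S w) (at 0)"
  using generates by (auto simp: generates_group_def C0_group_def)

lemma norm_U [simp]: "norm (U t w) = norm w"
  using isometric by (simp add: isometric_group_def)

lemma bounded_linear_U: "bounded_linear (U t)"
  using bounded_clinear_U by (simp add: bounded_clinear_def)

lemmas U_diff = linear_diff[OF bounded_linear.linear[OF bounded_linear_U]]
lemmas U_scaleR = linear_scale[OF bounded_linear.linear[OF bounded_linear_U]]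

lemma U_minus_cancel [simp]: "U (- t) (U t w) = w" "U t (U (- t) w) = w"
  using U_add[of "- t" t w] U_add[of t "- t" w] by simp_all

lemma continuous_on_U: "continuous_on X (\<lambda>t. U t w)"
proof -
  have "isCont (\<lambda>t. U t w) a" for a
  proof -
    have "((\<lambda>h. U a (U h w)) \<longlongrightarrow> U a w) (at 0)"
      using bounded_linear.tendsto[OF bounded_linear_U U_tendsto] .
    then show ?thesis
      by (simp add: isCont_iff LIM_isCont_iff U_add)
  qed
  then show ?thesis
    by (simp add: continuous_at_imp_continuous_on)
qed

text \<open>A one-sided derivative of an orbit at \<open>0\<close> is two-sided, since the quotient at \<open>- h\<close> is
  \<open>U (- h)\<close> applied to the one at \<open>h\<close>; the group therefore has the same generator as its restriction
  to nonnegative times.\<close>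

lemma left_quotient_tendsto:
  assumes "((\<lambda>h. (U h w - w) /\<^sub>R h) \<longlongrightarrow> v) (at_right 0)"
  shows "((\<lambda>h. (U h w - w) /\<^sub>R h) \<longlongrightarrow> v) (at 0)"
proof -
  have "((\<lambda>h. U (- h) v) \<longlongrightarrow> v) (at_right 0)"
  proof -
    have "continuous_on UNIV (\<lambda>h. U (- h) v)"
      using continuous_on_compose2[OF continuous_on_U[of UNIV v], of UNIV "\<lambda>h. - h"]
      by (simp add: continuous_intros)
    then have "isCont (\<lambda>h. U (- h) v) 0"
      by (simp add: continuous_on_eq_continuous_at)
    then have "((\<lambda>h. U (- h) v) \<longlongrightarrow> U (- 0) v) (at 0)"
      by (simp only: isCont_def)
    then show ?thesis
      by (simp add: filterlim_at_split)
  qed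
  moreover have "((\<lambda>h. U (- h) ((U h w - w) /\<^sub>R h - v)) \<longlongrightarrow> 0) (at_right 0)"
    using assms by (subst tendsto_norm_zero_iff[symmetric]) (simp add: tendsto_norm_zero LIM_zero)
  ultimately have "((\<lambda>h. U (- h) v + U (- h) ((U h w - w) /\<^sub>R h - v)) \<longlongrightarrow> v + 0) (at_right 0)"
    by (rule tendsto_add)
  then have "((\<lambda>h. (U (- h) w - w) /\<^sub>R (- h)) \<longlongrightarrow> v) (at_right 0)"
    by (simp add: U_diff U_scaleR scaleR_diff_right)
  then have "((\<lambda>h. (U h w - w) /\<^sub>R h) \<longlongrightarrow> v) (at_left 0)"
    by (simp add: filterlim_at_left_to_right)
  with assms show ?thesis
    by (simp add: filterlim_at_split)
qed

lemma generates_semigroup_U: "generates_semigroup D S U"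
proof -
  have right: "(f \<longlongrightarrow> v) (at_right 0)" if "(f \<longlongrightarrow> v) (at 0)" for f :: "real \<Rightarrow> 'w" and v
    using that by (simp add: filterlim_at_split)
  have "C0_semigroup U"
    unfolding C0_semigroup_def by (auto simp: bounded_clinear_U U_add intro: right U_tendsto)
  moreover have "D = {w. \<exists>v. ((\<lambda>h. (U h w - w) /\<^sub>R h) \<longlongrightarrow> v) (at_right 0)}"
    using D_iff_quotient right left_quotient_tendsto by blast
  ultimately show ?thesis
    unfolding generates_semigroup_def by (intro conjI ballI right S_tendsto)
qed

sublocale bounded_C0_semigroup D S U 1
  by standard (simp_all add: generates_semigroup_U)

lemma U_in_D: "w \<in> D \<Longrightarrow> U t w \<in> D"
  and S_U: "w \<in> D \<Longrightarrow> S (U t w) = U t (S w)"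
proof -
  have comm: "U t (U s w) = U s (U t w)" for s w
    using U_add[of s t w] U_add[of t s w] by (simp add: add.commute)
  show "w \<in> D \<Longrightarrow> U t w \<in> D" "w \<in> D \<Longrightarrow> S (U t w) = U t (S w)"
    by (rule commute_generator[of "U t"], rule bounded_linear_U, rule comm, assumption)+
qed

lemma U_has_vector_derivative:
  assumes "w \<in> D"
  shows "((\<lambda>t. U t w) has_vector_derivative S (U t w)) (at t)"
proof -
  have "((\<lambda>h. U t ((U h w - w) /\<^sub>R h)) \<longlongrightarrow> U t (S w)) (at 0)"
    using bounded_linear.tendsto[OF bounded_linear_U S_tendsto[OF assms]] .
  then have "((\<lambda>h. (U (t + h) w - U t w) /\<^sub>R h) \<longlongrightarrow> U t (S w)) (at 0)"
    by (simp add: U_scaleR U_diff U_add)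
  then have "((\<lambda>s. (U s w - U t w) /\<^sub>R (s - t)) \<longlongrightarrow> U t (S w)) (at t)"
    by (simp add: filterlim_at_to_0[of _ _ t] add.commute)
  then show ?thesis
    using assms by (simp add: has_vector_derivative_iff_quotient S_U)
qed

end

section \<open>The Sylvester equation and the forced semigroup\<close>

context bounded_C0_semigroup
begin

lemma T_product_has_vector_derivative:
  assumes v: "(v has_vector_derivative v') (at s)" and D: "v s \<in> D" and s: "s < t"
  shows "((\<lambda>r. T (t - r) (v r)) has_vector_derivative T (t - s) (v' - G (v s))) (at s)"
proof -
  have near: "\<forall>\<^sub>F r in at s. r < t"
    using s by (simp add: order_tendstoD(2)[OF tendsto_ident_at])
  have "((\<lambda>r. T (t - r) ((v r - v s) /\<^sub>R (r - s))) \<longlongrightarrow> T (t - s) v') (at s)"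
  proof (rule tendsto_T)
    show "((\<lambda>r. (v r - v s) /\<^sub>R (r - s)) \<longlongrightarrow> v') (at s)"
      using v by (simp add: has_vector_derivative_iff_quotient)
    show "\<forall>\<^sub>F r in at s. 0 \<le> t - r"
      using near by eventually_elim simp
  qed (use s in \<open>auto intro!: tendsto_intros\<close>)
  moreover have "((\<lambda>r. (T (t - r) (v s) - T (t - s) (v s)) /\<^sub>R (r - s)) \<longlongrightarrow> - T (t - s) (G (v s))) (at s)"
  proof -
    have "((\<lambda>r. t - r) has_vector_derivative - 1) (at s)"
      by (auto intro!: derivative_eq_intros)
    moreover have "((\<lambda>r. T r (v s)) has_vector_derivative T (t - s) (G (v s))) (at (t - s))"
      using D s by (intro orbit_has_vector_derivative_at) auto
    ultimately have "((\<lambda>r. T r (v s)) \<circ> (\<lambda>r. t - r) has_vector_derivative - 1 *\<^sub>R T (t - s) (G (v s))) (at s)"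
      by (rule vector_diff_chain_at)
    then show ?thesis
      by (simp add: has_vector_derivative_iff_quotient o_def)
  qed
  ultimately have "((\<lambda>r. T (t - r) ((v r - v s) /\<^sub>R (r - s)) + (T (t - r) (v s) - T (t - s) (v s)) /\<^sub>R (r - s))
      \<longlongrightarrow> T (t - s) v' + - T (t - s) (G (v s))) (at s)"
    by (rule tendsto_add)
  moreover have "\<forall>\<^sub>F r in at s. T (t - r) ((v r - v s) /\<^sub>R (r - s)) + (T (t - r) (v s) - T (t - s) (v s)) /\<^sub>R (r - s)
      = (T (t - r) (v r) - T (t - s) (v s)) /\<^sub>R (r - s)"
    using near by eventually_elim (simp add: T_scaleR T_diff flip: scaleR_add_right)
  ultimately have "((\<lambda>r. (T (t - r) (v r) - T (t - s) (v s)) /\<^sub>R (r - s))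
      \<longlongrightarrow> T (t - s) v' + - T (t - s) (G (v s))) (at s)"
    by (rule Lim_transform_eventually)
  then show ?thesis
    using s by (simp add: has_vector_derivative_iff_quotient T_diff)
qed

end

lemma integral_reflect_Icc:
  fixes f :: "real \<Rightarrow> 'a::banach"
  shows "integral {0..t} (\<lambda>s. f (t - s)) = integral {0..t} f"
proof -
  have "integral {0..t} (\<lambda>s. f (t - s)) = integral {- t..- 0} (\<lambda>s. f (t - - s))"
    using Henstock_Kurzweil_Integration.integral_reflect_real[of t 0 "\<lambda>s. f (t - s)"] by simp
  also have "\<dots> = integral {0..t} f"
    using integral_shift_real_ivl[of t 0 "- t" f] integral_shift_real_ivl[of 0 t t f] by (simp add: add.commute)
  finally show ?thesis .
qed

locale forced_semigroup =
  bounded_C0_semigroup DZ G T M + exo: isometric_C0_group DW S U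
  for DZ :: "'z::complex_banach set" and G T M and DW :: "'w::complex_banach set" and S U +
  fixes \<Delta> :: "'w \<Rightarrow> 'z"
  assumes \<Delta>: "bounded_clinear \<Delta>"
begin

lemma bounded_linear_\<Delta>: "bounded_linear \<Delta>"
  using \<Delta> by (simp add: bounded_clinear_def)

lemma continuous_on_forcing:
  assumes "continuous_on X f" "continuous_on X g" "\<And>s. s \<in> X \<Longrightarrow> 0 \<le> f s"
  shows "continuous_on X (\<lambda>s. T (f s) (\<Delta> (U (g s) w)))"
  using assms
  by (intro continuous_on_T bounded_linear.continuous_on[OF bounded_linear_\<Delta>]
      continuous_on_compose2[OF exo.continuous_on_U[of UNIV]]) auto

definition solves_sylvester :: "('w \<Rightarrow> 'z) \<Rightarrow> bool" where
  "solves_sylvester \<Pi>\<^sub>0 \<longleftrightarrow> bounded_clinear \<Pi>\<^sub>0 \<and> (\<forall>w\<in>DW. \<Pi>\<^sub>0 w \<in> DZ \<and> G (\<Pi>\<^sub>0 w) + \<Delta> w = \<Pi>\<^sub>0 (S w))"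

lemma forcing_bound:
  obtains k where "0 \<le> k" "\<And>t s w. 0 \<le> t \<Longrightarrow> norm (T t (\<Delta> (U s w))) \<le> k * norm w"
proof -
  obtain k where k: "0 \<le> k" "\<And>w. norm (\<Delta> w) \<le> norm w * k"
    using bounded_linear.nonneg_bounded[OF bounded_linear_\<Delta>] by blast
  have "norm (T t (\<Delta> (U s w))) \<le> (M * k) * norm w" if "0 \<le> t" for t s w
    using order_trans[OF norm_T[OF that] mult_left_mono[OF k(2)[of "U s w"] M_nonneg]] by (simp add: ac_simps)
  then show thesis
    using that[of "M * k"] k(1) M_nonneg by simp
qed

text \<open>The derivative of \<open>s \<mapsto> T (t - s) (\<Pi>\<^sub>0 (U s w))\<close> is the forcing term, by the Sylvester equation.
  Both sides depend continuously on \<open>w\<close>, so the restriction to the domain of \<open>S\<close> can be dropped.\<close>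

lemma sylvester_variation_of_constants:
  assumes \<Pi>\<^sub>0: "solves_sylvester \<Pi>\<^sub>0" and t: "0 \<le> t"
  shows "integral {0..t} (\<lambda>s. T (t - s) (\<Delta> (U s w))) = \<Pi>\<^sub>0 (U t w) - T t (\<Pi>\<^sub>0 w)"
proof -
  have blin: "bounded_linear \<Pi>\<^sub>0" and syl: "\<And>w. w \<in> DW \<Longrightarrow> \<Pi>\<^sub>0 w \<in> DZ"
      "\<And>w. w \<in> DW \<Longrightarrow> G (\<Pi>\<^sub>0 w) + \<Delta> w = \<Pi>\<^sub>0 (S w)"
    using \<Pi>\<^sub>0 by (auto simp: solves_sylvester_def bounded_clinear_def)
  have on_domain: "integral {0..t} (\<lambda>s. T (t - s) (\<Delta> (U s w))) = \<Pi>\<^sub>0 (U t w) - T t (\<Pi>\<^sub>0 w)" if w: "w \<in> DW" for w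
  proof -
    have "((\<lambda>s. T (t - s) (\<Delta> (U s w))) has_integral T (t - t) (\<Pi>\<^sub>0 (U t w)) - T (t - 0) (\<Pi>\<^sub>0 (U 0 w))) {0..t}"
    proof (rule fundamental_theorem_of_calculus_interior[OF t])
      show "continuous_on {0..t} (\<lambda>s. T (t - s) (\<Pi>\<^sub>0 (U s w)))"
        by (intro continuous_on_T bounded_linear.continuous_on[OF blin] exo.continuous_on_U continuous_intros) auto
      show "((\<lambda>s. T (t - s) (\<Pi>\<^sub>0 (U s w))) has_vector_derivative T (t - s) (\<Delta> (U s w))) (at s)"
        if s: "s \<in> {0<..<t}" for s
      proof -
        have "((\<lambda>s. \<Pi>\<^sub>0 (U s w)) has_vector_derivative \<Pi>\<^sub>0 (S (U s w))) (at s)"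
          by (intro bounded_linear.has_vector_derivative[OF blin] exo.U_has_vector_derivative w)
        then have "((\<lambda>s. T (t - s) (\<Pi>\<^sub>0 (U s w))) has_vector_derivative
            T (t - s) (\<Pi>\<^sub>0 (S (U s w)) - G (\<Pi>\<^sub>0 (U s w)))) (at s)"
          using s w by (intro T_product_has_vector_derivative syl exo.U_in_D) auto
        moreover have "\<Pi>\<^sub>0 (S (U s w)) - G (\<Pi>\<^sub>0 (U s w)) = \<Delta> (U s w)"
          using syl(2)[OF exo.U_in_D[OF w], of s] by (metis add_diff_cancel_left')
        ultimately show ?thesis
          by simp
      qed
    qed
    then show ?thesis
      by (simp add: integral_unique)
  qed
  obtain u where u: "\<And>n. u n \<in> DW" "u \<longlonglongrightarrow> w"
    using exo.D_approx by blast
  obtain k where k: "\<And>t s w. 0 \<le> t \<Longrightarrow> norm (T t (\<Delta> (U s w))) \<le> k * norm w"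
    using forcing_bound by metis
  have integral_diff: "integral {0..t} (\<lambda>s. T (t - s) (\<Delta> (U s (u n)))) - integral {0..t} (\<lambda>s. T (t - s) (\<Delta> (U s w)))
      = integral {0..t} (\<lambda>s. T (t - s) (\<Delta> (U s (u n - w))))" for n
    by (subst integral_diff[symmetric])
      (auto intro!: integral_cong integrable_continuous_interval continuous_on_forcing continuous_intros
        simp: exo.U_diff T_diff linear_diff[OF bounded_linear.linear[OF bounded_linear_\<Delta>]])
  have "(\<lambda>n. integral {0..t} (\<lambda>s. T (t - s) (\<Delta> (U s (u n))))) \<longlonglongrightarrow> integral {0..t} (\<lambda>s. T (t - s) (\<Delta> (U s w)))"
  proof (rule LIM_zero_cancel, rule Lim_null_comparison)
    have "norm (integral {0..t} (\<lambda>s. T (t - s) (\<Delta> (U s (u n - w))))) \<le> k * norm (u n - w) * (t - 0)" for n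
      using t k by (intro integral_bound continuous_on_forcing continuous_intros) auto
    then show "\<forall>\<^sub>F n in sequentially. norm (integral {0..t} (\<lambda>s. T (t - s) (\<Delta> (U s (u n))))
        - integral {0..t} (\<lambda>s. T (t - s) (\<Delta> (U s w)))) \<le> k * norm (u n - w) * (t - 0)"
      by (simp add: integral_diff)
    show "(\<lambda>n. k * norm (u n - w) * (t - 0)) \<longlonglongrightarrow> 0"
      using u(2) by (intro tendsto_mult_left_zero tendsto_mult_right_zero tendsto_norm_zero) (simp add: LIM_zero)
  qed
  moreover have "(\<lambda>n. \<Pi>\<^sub>0 (U t (u n)) - T t (\<Pi>\<^sub>0 (u n))) \<longlonglongrightarrow> \<Pi>\<^sub>0 (U t w) - T t (\<Pi>\<^sub>0 w)"
    using u(2) t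
    by (intro tendsto_diff bounded_linear.tendsto[OF blin] bounded_linear.tendsto[OF exo.bounded_linear_U]
        bounded_linear.tendsto[OF bounded_linear_T])
  ultimately show ?thesis
    unfolding on_domain[OF u(1)] by (rule LIMSEQ_unique)
qed

lemma sylvester_mild_state:
  assumes "solves_sylvester \<Pi>\<^sub>0" "0 \<le> t"
  shows "mild_state T U \<Delta> z w t = T t (z - \<Pi>\<^sub>0 w) + \<Pi>\<^sub>0 (U t w)"
  using assms by (simp add: mild_state_def sylvester_variation_of_constants T_diff)

lemma sylvester_truncated_integral:
  assumes "solves_sylvester \<Pi>\<^sub>0" "0 \<le> t"
  shows "integral {0..t} (\<lambda>s. T s (\<Delta> (U (- s) w))) = \<Pi>\<^sub>0 w - T t (\<Pi>\<^sub>0 (U (- t) w))"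
proof -
  have "integral {0..t} (\<lambda>s. T s (\<Delta> (U (- s) w))) = integral {0..t} (\<lambda>s. T (t - s) (\<Delta> (U (- (t - s)) w)))"
    by (rule integral_reflect_Icc[symmetric])
  also have "\<dots> = integral {0..t} (\<lambda>s. T (t - s) (\<Delta> (U s (U (- t) w))))"
    by (intro integral_cong) (simp add: exo.U_add[of s "- t" for s, simplified, symmetric])
  also have "\<dots> = \<Pi>\<^sub>0 w - T t (\<Pi>\<^sub>0 (U (- t) w))"
    using assms by (simp add: sylvester_variation_of_constants)
  finally show ?thesis .
qed

text \<open>Since \<open>G \<Pi> = \<Pi> S - \<Delta>\<close> and the graph norm of \<open>S\<close> is constant along orbits of the group, this bound
  makes the decay of the semigroup on its domain uniform along such an orbit.\<close>

lemma sylvester_generator_bound: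
  assumes "solves_sylvester \<Pi>\<^sub>0"
  obtains k where "0 \<le> k" "\<And>w. w \<in> DW \<Longrightarrow> norm (G (\<Pi>\<^sub>0 w)) \<le> k * graph_norm S w"
proof -
  have syl: "bounded_linear \<Pi>\<^sub>0" "\<And>w. w \<in> DW \<Longrightarrow> G (\<Pi>\<^sub>0 w) + \<Delta> w = \<Pi>\<^sub>0 (S w)"
    using assms by (auto simp: solves_sylvester_def bounded_clinear_def)
  obtain a where a: "0 \<le> a" "\<And>w. norm (\<Pi>\<^sub>0 w) \<le> norm w * a"
    using bounded_linear.nonneg_bounded[OF syl(1)] by blast
  obtain b where b: "0 \<le> b" "\<And>w. norm (\<Delta> w) \<le> norm w * b"
    using bounded_linear.nonneg_bounded[OF bounded_linear_\<Delta>] by blast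
  have "norm (G (\<Pi>\<^sub>0 w)) \<le> (a + b) * graph_norm S w" if "w \<in> DW" for w
  proof -
    have "G (\<Pi>\<^sub>0 w) = \<Pi>\<^sub>0 (S w) - \<Delta> w"
      using syl(2)[OF that] by (simp add: eq_diff_eq)
    then have "norm (G (\<Pi>\<^sub>0 w)) = norm (\<Pi>\<^sub>0 (S w) - \<Delta> w)"
      by simp
    also have "\<dots> \<le> norm (S w) * a + norm w * b"
      using norm_triangle_ineq4[of "\<Pi>\<^sub>0 (S w)" "\<Delta> w"] a(2)[of "S w"] b(2)[of w] by linarith
    also have "\<dots> \<le> (a + b) * graph_norm S w"
      using a b by (simp add: graph_norm_def algebra_simps)
    finally show ?thesis .
  qed
  with a b show thesis
    by (intro that[of "a + b"]) auto
qed

lemma graph_norm_U: "w \<in> DW \<Longrightarrow> graph_norm S (U t w) = graph_norm S w"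
  by (simp add: graph_norm_def exo.S_U)

end

section \<open>Conform operators and the Sylvester equation\<close>

lemma bounded_clinear_extension:
  fixes J :: "'a::complex_banach \<Rightarrow> 'b::complex_banach"
  assumes dense: "closure X = UNIV"
    and X: "\<And>x y. x \<in> X \<Longrightarrow> y \<in> X \<Longrightarrow> x + y \<in> X" "\<And>c x. x \<in> X \<Longrightarrow> c *\<^sub>C x \<in> X"
    and add: "\<And>x y. x \<in> X \<Longrightarrow> y \<in> X \<Longrightarrow> J (x + y) = J x + J y"
    and scale: "\<And>c x. x \<in> X \<Longrightarrow> J (c *\<^sub>C x) = c *\<^sub>C J x"
    and bound: "\<And>x. x \<in> X \<Longrightarrow> norm (J x) \<le> k * norm x"
  obtains F where "bounded_clinear F" "\<And>x. x \<in> X \<Longrightarrow> F x = J x"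
proof -
  have diff: "x - y \<in> X" "J (x - y) = J x - J y" if "x \<in> X" "y \<in> X" for x y
  proof -
    have minus: "(- 1) *\<^sub>C z = - z" for z :: "'c::complex_banach"
      using scaleC_of_real[of "- 1" z] by simp
    show "x - y \<in> X" "J (x - y) = J x - J y"
      using that X(1)[OF that(1) X(2)[OF that(2), of "- 1"]]
        add[OF that(1) X(2)[OF that(2), of "- 1"]] scale[OF that(2), of "- 1"]
      by (simp_all add: minus)
  qed
  have "uniformly_continuous_on X J"
  proof (unfold uniformly_continuous_on_def, intro allI impI)
    fix e :: real assume e: "0 < e"
    have "dist (J y) (J x) < e" if "x \<in> X" "y \<in> X" "dist y x < e / (\<bar>k\<bar> + 1)" for x y
    proof -
      have "dist (J y) (J x) \<le> k * dist y x"
        using bound[OF diff(1)[OF that(2,1)]] diff(2)[OF that(2,1)] by (simp add: dist_norm)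
      also have "\<dots> \<le> (\<bar>k\<bar> + 1) * dist y x"
        by (intro mult_right_mono) auto
      also have "\<dots> < e"
        using that(3) by (simp add: field_simps)
      finally show ?thesis .
    qed
    then show "\<exists>d>0. \<forall>x\<in>X. \<forall>y\<in>X. dist y x < d \<longrightarrow> dist (J y) (J x) < e"
      using e by (intro exI[of _ "e / (\<bar>k\<bar> + 1)"]) auto
  qed
  then obtain F where "uniformly_continuous_on (closure X) F" and F: "\<And>x. x \<in> X \<Longrightarrow> J x = F x"
    by (rule uniformly_continuous_on_extension_on_closure) (rule that)
  then have "continuous_on UNIV F"
    using uniformly_continuous_imp_continuous dense by metis
  then have cont: "(\<lambda>n. F (u n)) \<longlonglongrightarrow> F x" if "u \<longlonglongrightarrow> x" for u x
    using that by (rule continuous_on_tendsto_compose) auto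
  have approx: "\<exists>u. (\<forall>n. u n \<in> X) \<and> u \<longlonglongrightarrow> x" for x
    using closure_sequential[of x X] dense by simp
  have F_add: "F (x + y) = F x + F y" for x y
  proof -
    obtain u v where u: "\<And>n. u n \<in> X" "u \<longlonglongrightarrow> x" and v: "\<And>n. v n \<in> X" "v \<longlonglongrightarrow> y"
      using approx by metis
    have "(\<lambda>n. F (u n + v n)) \<longlonglongrightarrow> F (x + y)"
      using u v by (intro cont tendsto_add)
    moreover have "F (u n + v n) = F (u n) + F (v n)" for n
      using u(1) v(1) add[of "u n" "v n"] X(1) by (metis F)
    ultimately have "(\<lambda>n. F (u n) + F (v n)) \<longlonglongrightarrow> F (x + y)"
      by simp
    then show ?thesis
      using tendsto_add[OF cont[OF u(2)] cont[OF v(2)]] by (rule LIMSEQ_unique)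
  qed
  have F_scale: "F (c *\<^sub>C x) = c *\<^sub>C F x" for c x
  proof -
    obtain u where u: "\<And>n. u n \<in> X" "u \<longlonglongrightarrow> x"
      using approx by metis
    have "bounded_linear (scaleC c :: 'd::complex_banach \<Rightarrow> 'd)" for c
      by (rule bounded_linear_scaleC)
    note tendsto_scaleC = bounded_linear.tendsto[OF this]
    have "(\<lambda>n. F (c *\<^sub>C u n)) \<longlonglongrightarrow> F (c *\<^sub>C x)"
      using u by (intro cont tendsto_scaleC)
    moreover have "F (c *\<^sub>C u n) = c *\<^sub>C F (u n)" for n
      using u(1) scale X(2) by (metis F)
    ultimately have "(\<lambda>n. c *\<^sub>C F (u n)) \<longlonglongrightarrow> F (c *\<^sub>C x)"
      by simp
    then show ?thesis
      using tendsto_scaleC[OF cont[OF u(2)]] by (rule LIMSEQ_unique)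
  qed
  have "norm (F x) \<le> norm x * k" for x
  proof -
    obtain u where u: "\<And>n. u n \<in> X" "u \<longlonglongrightarrow> x"
      using approx by metis
    have "norm (F (u n)) \<le> norm (u n) * k" for n
      using bound[OF u(1)] F[OF u(1)] by (simp add: mult.commute)
    moreover have "(\<lambda>n. norm (u n) * k) \<longlonglongrightarrow> norm x * k"
      by (intro tendsto_intros u(2))
    ultimately show ?thesis
      by (intro LIMSEQ_le[OF tendsto_norm[OF cont[OF u(2)]]]) auto
  qed
  then have "bounded_clinear F"
    unfolding bounded_clinear_def
    by (intro conjI bounded_linear_intro[where K = k] F_add allI F_scale)
      (metis F_scale scaleC_of_real)
  then show thesis
    using that F by metis
qed

context forced_semigroup
begin

definition truncated :: "'w \<Rightarrow> real \<Rightarrow> 'z" where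
  "truncated w \<tau> = integral {0..\<tau>} (\<lambda>t. T t (\<Delta> (U (- t) w)))"

lemma forcing_integrable: "0 \<le> a \<Longrightarrow> (\<lambda>t. T t (\<Delta> (U (- t) w))) integrable_on {a..b}"
  by (intro integrable_continuous_interval continuous_on_forcing continuous_intros) auto

text \<open>Shifting time: \<open>T h\<close> moves the window of integration, and the exosystem compensates.\<close>

lemma T_truncated:
  assumes h: "0 \<le> h" and \<tau>: "0 \<le> \<tau>"
  shows "T h (truncated w \<tau>) = truncated (U h w) (\<tau> + h) - truncated (U h w) h"
proof -
  have "T h (truncated w \<tau>) = integral {0..\<tau>} (T h \<circ> (\<lambda>t. T t (\<Delta> (U (- t) w))))"
    unfolding truncated_def using h
    by (intro integral_linear[symmetric] forcing_integrable bounded_linear_T) auto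
  also have "\<dots> = integral {0..\<tau>} (\<lambda>t. T (t + h) (\<Delta> (U (- (t + h)) (U h w))))"
    using h by (intro integral_cong) (simp add: T_add[symmetric] exo.U_add[symmetric] add.commute)
  also have "\<dots> = integral {h..\<tau> + h} (\<lambda>t. T t (\<Delta> (U (- t) (U h w))))"
    using integral_shift_real_ivl[of h h "\<tau> + h" "\<lambda>t. T t (\<Delta> (U (- t) (U h w)))"] by simp
  also have "\<dots> = truncated (U h w) (\<tau> + h) - truncated (U h w) h"
    unfolding truncated_def
    using Henstock_Kurzweil_Integration.integral_combine[of 0 h "\<tau> + h" "\<lambda>t. T t (\<Delta> (U (- t) (U h w)))"]
      h \<tau> forcing_integrable[of 0 "U h w" "\<tau> + h"] by (simp add: algebra_simps)
  finally show ?thesis .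
qed

lemma truncated_quotient_tendsto: "((\<lambda>h. truncated (U h w) h /\<^sub>R h) \<longlongrightarrow> \<Delta> w) (at_right 0)"
proof -
  have "((\<lambda>h. truncated w h) has_vector_derivative T 0 (\<Delta> (U (- 0) w))) (at 0 within {0..1})"
    unfolding truncated_def
    by (intro integral_has_vector_derivative continuous_on_forcing continuous_intros) auto
  then have "((\<lambda>h. truncated w h /\<^sub>R h) \<longlongrightarrow> \<Delta> w) (at_right 0)"
    by (simp add: has_vector_derivative_iff_quotient at_within_Icc_at_right truncated_def)
  moreover have "((\<lambda>h. (truncated (U h w) h - truncated w h) /\<^sub>R h) \<longlongrightarrow> 0) (at_right 0)"
  proof -
    obtain k where k: "\<And>t s w. 0 \<le> t \<Longrightarrow> norm (T t (\<Delta> (U s w))) \<le> k * norm w"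
      using forcing_bound by metis
    have "norm ((truncated (U h w) h - truncated w h) /\<^sub>R h) \<le> k * norm (U h w - w)" if h: "0 < h" for h
    proof -
      have "truncated (U h w) h - truncated w h = integral {0..h} (\<lambda>t. T t (\<Delta> (U (- t) (U h w - w))))"
        unfolding truncated_def
        by (subst integral_diff[symmetric])
          (auto intro!: integral_cong forcing_integrable
            simp: exo.U_diff T_diff linear_diff[OF bounded_linear.linear[OF bounded_linear_\<Delta>]])
      also have "norm \<dots> \<le> k * norm (U h w - w) * (h - 0)"
        using h k by (intro integral_bound continuous_on_forcing continuous_intros) auto
      finally have "norm (truncated (U h w) h - truncated w h) / h \<le> k * norm (U h w - w)"
        using h by (simp add: pos_divide_le_eq)
      then show ?thesis
        using h by (simp only: norm_scaleR abs_inverse abs_of_pos divide_inverse mult.commute)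
    qed
    then have le: "\<forall>\<^sub>F h in at_right 0. norm ((truncated (U h w) h - truncated w h) /\<^sub>R h) \<le> k * norm (U h w - w)"
      using eventually_at_right_0 by (auto elim: eventually_mono)
    have "((\<lambda>h. k * norm (U h w - w)) \<longlongrightarrow> 0) (at_right 0)"
      using exo.T_tendsto[of w] by (intro tendsto_mult_right_zero tendsto_norm_zero) (simp add: LIM_zero)
    with le show ?thesis
      by (rule Lim_null_comparison)
  qed
  ultimately have "((\<lambda>h. truncated w h /\<^sub>R h + (truncated (U h w) h - truncated w h) /\<^sub>R h) \<longlongrightarrow> \<Delta> w + 0) (at_right 0)"
    by (rule tendsto_add)
  then show ?thesis
    by (simp flip: scaleR_add_right)
qed

text \<open>The improper integral \<open>J\<close> of a conform operator solves the Sylvester equation: letting \<open>\<tau>\<close> tend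
  to infinity in \<open>T_truncated\<close> gives \<open>T h (J w) = J (U h w) - truncated (U h w) h\<close>, which is differentiated at
  \<open>h = 0\<close>.\<close>

lemma conform_imp_sylvester:
  assumes "conform T DW U \<Delta>"
  obtains \<Pi>\<^sub>0 where "solves_sylvester \<Pi>\<^sub>0"
proof -
  obtain J k where lim: "\<And>w. w \<in> DW \<Longrightarrow> (truncated w \<longlongrightarrow> J w) at_top"
    and J: "\<And>v w. v \<in> DW \<Longrightarrow> w \<in> DW \<Longrightarrow> J (v + w) = J v + J w"
      "\<And>c w. w \<in> DW \<Longrightarrow> J (c *\<^sub>C w) = c *\<^sub>C J w"
      "\<And>w. w \<in> DW \<Longrightarrow> norm (J w) \<le> k * norm w"
    using assms unfolding conform_def truncated_def[abs_def] by blast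
  obtain \<Pi>\<^sub>0 where \<Pi>\<^sub>0: "bounded_clinear \<Pi>\<^sub>0" "\<And>w. w \<in> DW \<Longrightarrow> \<Pi>\<^sub>0 w = J w"
    using bounded_clinear_extension[OF exo.D_dense exo.G_add(1) exo.G_scaleC(1) J] by metis
  have blin: "bounded_linear \<Pi>\<^sub>0"
    using \<Pi>\<^sub>0(1) by (simp add: bounded_clinear_def)
  have shift: "T h (\<Pi>\<^sub>0 w) = \<Pi>\<^sub>0 (U h w) - truncated (U h w) h" if w: "w \<in> DW" and h: "0 \<le> h" for w h
  proof -
    have "((\<lambda>\<tau>. T h (truncated w \<tau>)) \<longlongrightarrow> T h (J w)) at_top"
      using bounded_linear.tendsto[OF bounded_linear_T[OF h] lim[OF w]] .
    moreover have "\<forall>\<^sub>F \<tau> in at_top. T h (truncated w \<tau>) = truncated (U h w) (\<tau> + h) - truncated (U h w) h"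
      using eventually_ge_at_top[of 0] by eventually_elim (rule T_truncated[OF h])
    ultimately have "((\<lambda>\<tau>. truncated (U h w) (\<tau> + h) - truncated (U h w) h) \<longlongrightarrow> T h (J w)) at_top"
      by (rule Lim_transform_eventually)
    moreover have "((\<lambda>\<tau>. truncated (U h w) (\<tau> + h)) \<longlongrightarrow> J (U h w)) at_top"
    proof (rule filterlim_compose[OF lim[OF exo.U_in_D[OF w]]])
      show "filterlim (\<lambda>\<tau>. \<tau> + h) at_top at_top"
        by real_asymp
    qed
    then have "((\<lambda>\<tau>. truncated (U h w) (\<tau> + h) - truncated (U h w) h) \<longlongrightarrow> J (U h w) - truncated (U h w) h) at_top"
      by (intro tendsto_diff tendsto_const)
    ultimately have "T h (J w) = J (U h w) - truncated (U h w) h"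
      by (rule tendsto_unique[OF trivial_limit_at_top_linorder])
    then show ?thesis
      using w exo.U_in_D[OF w] by (simp add: \<Pi>\<^sub>0(2))
  qed
  have "\<Pi>\<^sub>0 w \<in> DZ" "G (\<Pi>\<^sub>0 w) = \<Pi>\<^sub>0 (S w) - \<Delta> w" if w: "w \<in> DW" for w
  proof -
    have "((\<lambda>h. \<Pi>\<^sub>0 ((U h w - w) /\<^sub>R h) - truncated (U h w) h /\<^sub>R h) \<longlongrightarrow> \<Pi>\<^sub>0 (S w) - \<Delta> w) (at_right 0)"
      by (intro tendsto_diff bounded_linear.tendsto[OF blin] exo.G_tendsto w truncated_quotient_tendsto)
    moreover have "\<forall>\<^sub>F h in at_right 0. \<Pi>\<^sub>0 ((U h w - w) /\<^sub>R h) - truncated (U h w) h /\<^sub>R h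
        = (T h (\<Pi>\<^sub>0 w) - \<Pi>\<^sub>0 w) /\<^sub>R h"
      using eventually_at_right_0
      by eventually_elim (simp add: shift[OF w] linear_scale[OF bounded_linear.linear[OF blin]]
          linear_diff[OF bounded_linear.linear[OF blin]] algebra_simps)
    ultimately have "((\<lambda>h. (T h (\<Pi>\<^sub>0 w) - \<Pi>\<^sub>0 w) /\<^sub>R h) \<longlongrightarrow> \<Pi>\<^sub>0 (S w) - \<Delta> w) (at_right 0)"
      by (rule Lim_transform_eventually)
    then show "\<Pi>\<^sub>0 w \<in> DZ" "G (\<Pi>\<^sub>0 w) = \<Pi>\<^sub>0 (S w) - \<Delta> w"
      by (rule generatorI)+
  qed
  then show thesis
    using \<Pi>\<^sub>0(1) that[of \<Pi>\<^sub>0] by (simp add: solves_sylvester_def)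
qed

text \<open>The truncated integral at \<open>t\<close> misses \<open>\<Pi> w\<close> by \<open>T t (\<Pi> (U (- t) w))\<close>. This vanishes in the limit
  because \<open>\<Pi> (U (- t) w)\<close> stays bounded in the graph norm of \<open>G\<close>.\<close>

lemma sylvester_imp_conform:
  assumes \<Pi>\<^sub>0: "solves_sylvester \<Pi>\<^sub>0" and \<alpha>: "decay_exponent DZ G T \<alpha>"
  shows "conform T DW U \<Delta>"
proof -
  have clin: "bounded_clinear \<Pi>\<^sub>0" and dom: "\<And>w. w \<in> DW \<Longrightarrow> \<Pi>\<^sub>0 w \<in> DZ"
    using \<Pi>\<^sub>0 by (auto simp: solves_sylvester_def)
  then have blin: "bounded_linear \<Pi>\<^sub>0"
    by (simp add: bounded_clinear_def)
  obtain N where N: "0 < N" "\<And>x t. x \<in> DZ \<Longrightarrow> 0 < t \<Longrightarrow> norm (T t x) \<le> N * t powr (- 1 / \<alpha>) * norm (G x)"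
    using decay_on_domain[OF \<alpha>] by metis
  obtain k where k: "\<And>w. w \<in> DW \<Longrightarrow> norm (G (\<Pi>\<^sub>0 w)) \<le> k * graph_norm S w"
    using sylvester_generator_bound[OF \<Pi>\<^sub>0] by metis
  have "(truncated w \<longlongrightarrow> \<Pi>\<^sub>0 w) at_top" if w: "w \<in> DW" for w
  proof -
    have "((\<lambda>t. T t (\<Pi>\<^sub>0 (U (- t) w))) \<longlongrightarrow> 0) at_top"
    proof (rule Lim_null_comparison)
      show "\<forall>\<^sub>F t in at_top. norm (T t (\<Pi>\<^sub>0 (U (- t) w))) \<le> t powr (- 1 / \<alpha>) * (N * (k * graph_norm S w))"
        using eventually_gt_at_top[of 0]
      proof eventually_elim
        case (elim t)
        have "norm (T t (\<Pi>\<^sub>0 (U (- t) w))) \<le> N * t powr (- 1 / \<alpha>) * norm (G (\<Pi>\<^sub>0 (U (- t) w)))"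
          using elim w by (intro N dom exo.U_in_D) auto
        also have "\<dots> \<le> N * t powr (- 1 / \<alpha>) * (k * graph_norm S w)"
          using N(1) k[OF exo.U_in_D[OF w]] by (intro mult_left_mono) (auto simp: graph_norm_U w)
        finally show ?case
          by (simp add: ac_simps)
      qed
      show "((\<lambda>t. t powr (- 1 / \<alpha>) * (N * (k * graph_norm S w))) \<longlongrightarrow> 0) at_top"
        by (intro tendsto_mult_left_zero decay_tendsto_0[OF \<alpha>])
    qed
    then have "((\<lambda>t. \<Pi>\<^sub>0 w - T t (\<Pi>\<^sub>0 (U (- t) w))) \<longlongrightarrow> \<Pi>\<^sub>0 w - 0) at_top"
      by (intro tendsto_diff tendsto_const)
    moreover have "\<forall>\<^sub>F t in at_top. \<Pi>\<^sub>0 w - T t (\<Pi>\<^sub>0 (U (- t) w)) = truncated w t"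
      using eventually_ge_at_top[of 0]
      by eventually_elim (simp add: truncated_def sylvester_truncated_integral[OF \<Pi>\<^sub>0])
    ultimately show ?thesis
      using Lim_transform_eventually by fastforce
  qed
  moreover have "\<exists>k. \<forall>w\<in>DW. norm (\<Pi>\<^sub>0 w) \<le> k * norm w"
    using bounded_linear.bounded[OF blin] by (metis mult.commute)
  ultimately show ?thesis
    unfolding conform_def truncated_def[abs_def] using \<Delta> clin linear_add[OF bounded_linear.linear[OF blin]]
    by (intro conjI exI[of _ \<Pi>\<^sub>0]) (auto simp: bounded_clinear_def)
qed

lemma sylvester_tracking_error:
  assumes "solves_sylvester \<Pi>\<^sub>0" "0 \<le> t" "bounded_linear C"
  shows "tracking_error C Q T U \<Delta> z w t = C (T t (z - \<Pi>\<^sub>0 w)) + (C (\<Pi>\<^sub>0 (U t w)) - Q (U t w))"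
  using assms by (simp add: tracking_error_def sylvester_mild_state linear_add bounded_linear.linear)

end

section \<open>The regulator equations\<close>

lemma bounded_clinear_bound:
  assumes "bounded_clinear f"
  obtains k where "0 \<le> k" "\<And>x. norm (f x) \<le> k * norm x"
  using bounded_linear.nonneg_bounded[of f] assms by (metis bounded_clinear_def mult.commute)

lemma bounded_clinear_add: "bounded_clinear f \<Longrightarrow> bounded_clinear g \<Longrightarrow> bounded_clinear (\<lambda>x. f x + g x)"
  by (simp add: bounded_clinear_def bounded_linear_add scaleC_add_right)

lemma bounded_clinear_compose:
  "bounded_clinear f \<Longrightarrow> bounded_clinear g \<Longrightarrow> bounded_clinear (\<lambda>x. f (g x))"
  by (simp add: bounded_clinear_def bounded_linear_compose)

lemma bounded_C0_semigroupI:
  assumes gen: "generates_semigroup D G T" and bounded: "bounded_semigroup T"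
  obtains M where "bounded_C0_semigroup D G T M"
proof -
  obtain M where M: "\<And>t. 0 \<le> t \<Longrightarrow> onorm (T t) \<le> M"
    using bounded by (auto simp: bounded_semigroup_def)
  have blin: "bounded_linear (T t)" if "0 \<le> t" for t
    using gen that by (simp add: generates_semigroup_def C0_semigroup_def bounded_clinear_def)
  have "0 \<le> M"
    using onorm_pos_le[OF blin[of 0]] M[of 0] by simp
  moreover have "norm (T t x) \<le> M * norm x" if "0 \<le> t" for t x
    using onorm[OF blin[OF that], of x] M[OF that] by (meson mult_right_mono norm_ge_zero order_trans)
  ultimately show thesis
    using gen by (intro that[of M] bounded_C0_semigroup.intro)
qed

theorem theorem4p9:
  fixes A :: "'z::complex_banach \<Rightarrow> 'z" and DA :: "'z set" and TA :: "real \<Rightarrow> 'z \<Rightarrow> 'z"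
    and B :: "'u::complex_banach \<Rightarrow> 'z" and C :: "'z \<Rightarrow> 'y::complex_banach"
    and S :: "'w::complex_banach \<Rightarrow> 'w" and DS :: "'w set" and TS :: "real \<Rightarrow> 'w \<Rightarrow> 'w"
    and P :: "'w \<Rightarrow> 'z" and Q :: "'w \<Rightarrow> 'y"
    and K :: "'z \<Rightarrow> 'u" and L :: "'w \<Rightarrow> 'u" and TABK :: "real \<Rightarrow> 'z \<Rightarrow> 'z"
  assumes "generates_semigroup DA A TA"
    and "bounded_clinear B" and "bounded_clinear C"
    and "generates_group DS S TS" and "isometric_group TS"
    and "bounded_clinear P" and "bounded_clinear Q"
    and "bounded_clinear K" and "bounded_clinear L"
    and "generates_semigroup DA (\<lambda>z. A z + B (K z)) TABK"
    and "bounded_semigroup TABK" and "polynomially_stable TABK"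
  shows
    "(conform TABK DS TS (\<lambda>w. B (L w) + P w) \<and>
      solves_SFRP DA A B C DS TS P Q K L TABK \<and>
      (\<exists>\<beta>>0. \<exists>M>0. \<forall>z0\<in>DA. \<forall>w0\<in>DS. \<forall>t>0.
         norm (tracking_error C Q TABK TS (\<lambda>w. B (L w) + P w) z0 w0 t)
           \<le> M * t powr (- \<beta>) * (graph_norm A z0 + graph_norm S w0)))
     \<longleftrightarrow>
     (\<exists>\<Pi>\<^sub>0 \<Gamma>. bounded_clinear \<Pi>\<^sub>0 \<and> \<Pi>\<^sub>0 ` DS \<subseteq> DA \<and> bounded_clinear \<Gamma> \<and>
        L = (\<lambda>w. \<Gamma> w - K (\<Pi>\<^sub>0 w)) \<and>
        (\<forall>w\<in>DS. A (\<Pi>\<^sub>0 w) + B (\<Gamma> w) + P w = \<Pi>\<^sub>0 (S w)) \<and>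
        (\<forall>w. C (\<Pi>\<^sub>0 w) = Q w))"
proof -
  define G where "G z = A z + B (K z)" for z
  define \<Delta> where "\<Delta> w = B (L w) + P w" for w
  have G_fun: "(\<lambda>z. A z + B (K z)) = G" and \<Delta>_fun: "(\<lambda>w. B (L w) + P w) = \<Delta>"
    by (simp_all add: G_def \<Delta>_def fun_eq_iff)
  have blinB: "bounded_linear B" and blinC: "bounded_linear C" and blinQ: "bounded_linear Q"
    using assms(2,3,7) by (simp_all add: bounded_clinear_def)
  note linB = bounded_linear.linear[OF blinB]
  obtain M where "bounded_C0_semigroup DA G TABK M"
    using bounded_C0_semigroupI[OF assms(10,11)] unfolding G_fun .
  moreover have "bounded_clinear \<Delta>"
    unfolding \<Delta>_fun[symmetric]
    by (rule bounded_clinear_add[OF bounded_clinear_compose[OF assms(2,9)] assms(6)])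
  ultimately interpret forced_semigroup DA G TABK M DS S TS \<Delta>
    using assms(4,5) by (intro forced_semigroup.intro isometric_C0_group.intro forced_semigroup_axioms.intro)
  have "bounded_clinear (\<lambda>z. B (K z))"
    by (rule bounded_clinear_compose[OF assms(2,8)])
  then obtain b where b: "0 \<le> b" "\<And>z. norm (B (K z)) \<le> b * norm z"
    using bounded_clinear_bound by blast
  have graph_norm_nonneg: "0 \<le> graph_norm F x" for F :: "'c::complex_banach \<Rightarrow> 'd::complex_banach" and x
    by (simp add: graph_norm_def)
  show ?thesis
    unfolding \<Delta>_fun
  proof (intro iffI; (elim conjE exE bexE)?)
    fix \<beta> M'
    assume conf: "conform TABK DS TS \<Delta>" and \<beta>: "0 < \<beta>"
      and rate: "\<forall>z0\<in>DA. \<forall>w0\<in>DS. \<forall>t>0. norm (tracking_error C Q TABK TS \<Delta> z0 w0 t)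
           \<le> M' * t powr (- \<beta>) * (graph_norm A z0 + graph_norm S w0)" and M': "0 < M'"
    obtain \<Pi>\<^sub>0 where \<Pi>\<^sub>0: "solves_sylvester \<Pi>\<^sub>0"
      using conform_imp_sylvester[OF conf] .
    then have clin: "bounded_clinear \<Pi>\<^sub>0" and dom: "\<And>w. w \<in> DS \<Longrightarrow> \<Pi>\<^sub>0 w \<in> DA"
      and syl: "\<And>w. w \<in> DS \<Longrightarrow> G (\<Pi>\<^sub>0 w) + \<Delta> w = \<Pi>\<^sub>0 (S w)"
      by (auto simp: solves_sylvester_def)
    obtain a where a: "0 \<le> a" "\<And>w. norm (\<Pi>\<^sub>0 w) \<le> a * norm w"
      using bounded_clinear_bound[OF clin] by blast
    obtain k where k: "0 \<le> k" "\<And>w. w \<in> DS \<Longrightarrow> norm (G (\<Pi>\<^sub>0 w)) \<le> k * graph_norm S w"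
      using sylvester_generator_bound[OF \<Pi>\<^sub>0] by blast
    have A_bound: "graph_norm A (\<Pi>\<^sub>0 w) \<le> (a + k + b * a) * graph_norm S w" if "w \<in> DS" for w
    proof -
      have "norm (A (\<Pi>\<^sub>0 w)) \<le> norm (G (\<Pi>\<^sub>0 w)) + norm (B (K (\<Pi>\<^sub>0 w)))"
        using norm_triangle_ineq4[of "G (\<Pi>\<^sub>0 w)" "B (K (\<Pi>\<^sub>0 w))"] by (simp add: G_def)
      also have "\<dots> \<le> k * graph_norm S w + b * (a * norm w)"
        using b a k(2)[OF that] by (intro add_mono order_trans[OF b(2)] mult_left_mono)
      finally have "graph_norm A (\<Pi>\<^sub>0 w) \<le> k * graph_norm S w + (a + b * a) * norm w"
        using a(2)[of w] by (simp add: graph_norm_def algebra_simps)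
      also have "\<dots> \<le> k * graph_norm S w + (a + b * a) * graph_norm S w"
        using a b by (intro add_left_mono mult_left_mono) (auto simp: graph_norm_def)
      finally show ?thesis
        by (simp add: algebra_simps)
    qed
    have on_DS: "C (\<Pi>\<^sub>0 w) = Q w" if w: "w \<in> DS" for w
    proof -
      define c where "c = M' * ((a + k + b * a) * graph_norm S w + graph_norm S w)"
      \<comment> \<open>The exosystem started at \<open>v\<close> passes through \<open>w\<close> at time \<open>t\<close>, and the plant starts on the graph of
        the Sylvester solution, so the error at time \<open>t\<close> is exactly the defect at \<open>w\<close>.\<close>
      have defect: "norm (C (\<Pi>\<^sub>0 w) - Q w) \<le> c * t powr - \<beta>" if t: "0 < t" for t
      proof -
        define v where "v = TS (- t) w"
        have v: "v \<in> DS" "TS t v = w" "graph_norm S v = graph_norm S w"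
          using w by (simp_all add: v_def exo.U_in_D graph_norm_U)
        have "tracking_error C Q TABK TS \<Delta> (\<Pi>\<^sub>0 v) v t = C (\<Pi>\<^sub>0 w) - Q w"
          using t sylvester_tracking_error[OF \<Pi>\<^sub>0 _ blinC, of t Q "\<Pi>\<^sub>0 v" v]
          by (simp add: v linear_0 bounded_linear.linear blinC bounded_linear_T)
        then have "norm (C (\<Pi>\<^sub>0 w) - Q w) \<le> M' * t powr - \<beta> * (graph_norm A (\<Pi>\<^sub>0 v) + graph_norm S v)"
          using rate dom[OF v(1)] v(1) t by metis
        also have "\<dots> \<le> M' * t powr - \<beta> * ((a + k + b * a) * graph_norm S v + graph_norm S v)"
          using A_bound[OF v(1)] M' by (intro mult_left_mono add_mono) auto
        finally show ?thesis
          by (simp add: c_def v(3) ac_simps)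
      qed
      have "\<forall>\<^sub>F t in at_top. norm (C (\<Pi>\<^sub>0 w) - Q w) \<le> c * t powr - \<beta>"
        using eventually_gt_at_top[of 0] by eventually_elim (rule defect)
      moreover have "((\<lambda>t. c * t powr - \<beta>) \<longlongrightarrow> 0) at_top"
        using \<beta> by real_asymp
      ultimately have "norm (C (\<Pi>\<^sub>0 w) - Q w) \<le> 0"
        by (intro tendsto_lowerbound[OF _ _ trivial_limit_at_top_linorder])
      then show ?thesis
        by simp
    qed
    have CQ: "C (\<Pi>\<^sub>0 w) = Q w" for w
    proof -
      obtain u where u: "\<And>n. u n \<in> DS" "u \<longlonglongrightarrow> w"
        using exo.D_approx by blast
      have "(\<lambda>n. C (\<Pi>\<^sub>0 (u n))) \<longlonglongrightarrow> C (\<Pi>\<^sub>0 w)"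
        using clin u(2)
        by (intro bounded_linear.tendsto[OF blinC] bounded_linear.tendsto[of \<Pi>\<^sub>0]) (simp_all add: bounded_clinear_def)
      moreover have "(\<lambda>n. C (\<Pi>\<^sub>0 (u n))) \<longlonglongrightarrow> Q w"
        using bounded_linear.tendsto[OF blinQ u(2)] by (simp add: on_DS[OF u(1)])
      ultimately show ?thesis
        by (rule LIMSEQ_unique)
    qed
    define \<Gamma> where "\<Gamma> w = L w + K (\<Pi>\<^sub>0 w)" for w
    have "bounded_clinear \<Gamma>"
      unfolding \<Gamma>_def[abs_def]
      by (rule bounded_clinear_add[OF assms(9) bounded_clinear_compose[OF assms(8) clin]])
    moreover have "A (\<Pi>\<^sub>0 w) + B (\<Gamma> w) + P w = \<Pi>\<^sub>0 (S w)" if "w \<in> DS" for w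
      using syl[OF that] by (simp add: G_def \<Delta>_def \<Gamma>_def linear_add[OF linB] ac_simps)
    ultimately show "\<exists>\<Pi>\<^sub>0 \<Gamma>. bounded_clinear \<Pi>\<^sub>0 \<and> \<Pi>\<^sub>0 ` DS \<subseteq> DA \<and> bounded_clinear \<Gamma> \<and>
        L = (\<lambda>w. \<Gamma> w - K (\<Pi>\<^sub>0 w)) \<and>
        (\<forall>w\<in>DS. A (\<Pi>\<^sub>0 w) + B (\<Gamma> w) + P w = \<Pi>\<^sub>0 (S w)) \<and>
        (\<forall>w. C (\<Pi>\<^sub>0 w) = Q w)"
      using clin dom CQ by (intro exI[of _ \<Pi>\<^sub>0] exI[of _ \<Gamma>]) (auto simp: \<Gamma>_def)
  next
    fix \<Pi>\<^sub>0 \<Gamma>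
    assume clin: "bounded_clinear \<Pi>\<^sub>0" and dom: "\<Pi>\<^sub>0 ` DS \<subseteq> DA" and "bounded_clinear \<Gamma>"
      and L: "L = (\<lambda>w. \<Gamma> w - K (\<Pi>\<^sub>0 w))"
      and reg: "\<forall>w\<in>DS. A (\<Pi>\<^sub>0 w) + B (\<Gamma> w) + P w = \<Pi>\<^sub>0 (S w)" and CQ: "\<forall>w. C (\<Pi>\<^sub>0 w) = Q w"
    have "G (\<Pi>\<^sub>0 w) + \<Delta> w = \<Pi>\<^sub>0 (S w)" if "w \<in> DS" for w
      using reg that by (auto simp: G_def \<Delta>_def L linear_diff[OF linB] algebra_simps)
    then have \<Pi>\<^sub>0: "solves_sylvester \<Pi>\<^sub>0"
      using clin dom by (auto simp: solves_sylvester_def)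
    have error: "tracking_error C Q TABK TS \<Delta> z w t = C (TABK t (z - \<Pi>\<^sub>0 w))" if "0 \<le> t" for z w t
      using sylvester_tracking_error[OF \<Pi>\<^sub>0 that blinC] CQ by simp
    obtain c where c: "0 \<le> c" "\<And>z. norm (C z) \<le> c * norm z"
      using bounded_clinear_bound[OF assms(3)] by blast
    obtain k where k: "0 \<le> k" "\<And>w. w \<in> DS \<Longrightarrow> norm (G (\<Pi>\<^sub>0 w)) \<le> k * graph_norm S w"
      using sylvester_generator_bound[OF \<Pi>\<^sub>0] by blast
    have G_bound: "norm (G (z - \<Pi>\<^sub>0 w)) \<le> (1 + b + k) * (graph_norm A z + graph_norm S w)"
      if z: "z \<in> DA" and w: "w \<in> DS" for z w
    proof -
      have "norm (G (z - \<Pi>\<^sub>0 w)) \<le> norm (G z) + norm (G (\<Pi>\<^sub>0 w))"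
        using z w dom norm_triangle_ineq4 by (subst G_diff) auto
      also have "norm (G z) \<le> norm (A z) + b * norm z"
        unfolding G_def using norm_triangle_ineq[of "A z" "B (K z)"] b(2)[of z] by linarith
      also have "norm (A z) + b * norm z \<le> (1 + b) * graph_norm A z"
        using b(1) by (simp add: graph_norm_def algebra_simps)
      also have "(1 + b) * graph_norm A z + norm (G (\<Pi>\<^sub>0 w))
          \<le> (1 + b + k) * graph_norm A z + (1 + b + k) * graph_norm S w"
      proof (rule add_mono)
        show "(1 + b) * graph_norm A z \<le> (1 + b + k) * graph_norm A z"
          using k(1) graph_norm_nonneg by (intro mult_right_mono) auto
        show "norm (G (\<Pi>\<^sub>0 w)) \<le> (1 + b + k) * graph_norm S w"
          using b(1) graph_norm_nonneg
          by (intro order_trans[OF k(2)[OF w]] mult_right_mono) auto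
      qed
      finally show ?thesis
        by (simp add: distrib_left)
    qed
    have rate: "\<exists>N>0. \<forall>z0\<in>DA. \<forall>w0\<in>DS. \<forall>t>0. norm (tracking_error C Q TABK TS \<Delta> z0 w0 t)
           \<le> N * t powr (- 1 / \<alpha>) * (graph_norm A z0 + graph_norm S w0)"
      if \<alpha>: "decay_exponent DA G TABK \<alpha>" for \<alpha>
    proof -
      obtain N where N: "0 < N" "\<And>x t. x \<in> DA \<Longrightarrow> 0 < t \<Longrightarrow> norm (TABK t x) \<le> N * t powr (- 1 / \<alpha>) * norm (G x)"
        using decay_on_domain[OF \<alpha>] by metis
      have "norm (tracking_error C Q TABK TS \<Delta> z w t)
          \<le> ((c + 1) * (N * (1 + b + k))) * t powr (- 1 / \<alpha>) * (graph_norm A z + graph_norm S w)"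
        if z: "z \<in> DA" and w: "w \<in> DS" and t: "0 < t" for z w t
      proof -
        have "z - \<Pi>\<^sub>0 w \<in> DA"
          using z w dom by (intro G_diff) auto
        then have "norm (TABK t (z - \<Pi>\<^sub>0 w)) \<le> N * t powr (- 1 / \<alpha>) * norm (G (z - \<Pi>\<^sub>0 w))"
          using t by (rule N(2))
        also have "\<dots> \<le> N * t powr (- 1 / \<alpha>) * ((1 + b + k) * (graph_norm A z + graph_norm S w))"
          using N(1) G_bound[OF z w] by (intro mult_left_mono) auto
        finally have "(c + 1) * norm (TABK t (z - \<Pi>\<^sub>0 w))
            \<le> (c + 1) * (N * t powr (- 1 / \<alpha>) * ((1 + b + k) * (graph_norm A z + graph_norm S w)))"
          using c(1) by (intro mult_left_mono) auto
        moreover have "norm (C (TABK t (z - \<Pi>\<^sub>0 w))) \<le> (c + 1) * norm (TABK t (z - \<Pi>\<^sub>0 w))"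
          using c(2)[of "TABK t (z - \<Pi>\<^sub>0 w)"] by (simp add: distrib_right add_increasing2)
        ultimately show ?thesis
          using t by (simp add: error ac_simps)
      qed
      then show ?thesis
        using N(1) b(1) k(1) c(1) by (intro exI[of _ "(c + 1) * (N * (1 + b + k))"]) auto
    qed
    obtain \<alpha> where \<alpha>: "decay_exponent DA G TABK \<alpha>"
      using polynomially_stable_decay_exponent[OF assms(12)] by blast
    have "(tracking_error C Q TABK TS \<Delta> z w \<longlongrightarrow> 0) at_top" for z w
    proof -
      have "((\<lambda>t. C (TABK t (z - \<Pi>\<^sub>0 w))) \<longlongrightarrow> C 0) at_top"
        by (intro bounded_linear.tendsto[OF blinC] strongly_stable[OF \<alpha>])
      moreover have "\<forall>\<^sub>F t in at_top. C (TABK t (z - \<Pi>\<^sub>0 w)) = tracking_error C Q TABK TS \<Delta> z w t"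
        using eventually_ge_at_top[of 0] by eventually_elim (simp add: error)
      ultimately show ?thesis
        using Lim_transform_eventually linear_0[OF bounded_linear.linear[OF blinC]] by fastforce
    qed
    moreover have "\<exists>m>0. \<forall>t>0. norm (tracking_error C Q TABK TS \<Delta> z w t) \<le> m * t powr (- 1 / \<alpha>)"
      if zw: "decay_exponent DA G TABK \<alpha>" "z \<in> DA" "w \<in> DS" for \<alpha> z w
    proof -
      obtain N where N: "0 < N" and le: "\<And>t. 0 < t \<Longrightarrow> norm (tracking_error C Q TABK TS \<Delta> z w t)
          \<le> N * t powr (- 1 / \<alpha>) * (graph_norm A z + graph_norm S w)"
        using rate[OF zw(1)] zw(2,3) by blast
      have "norm (tracking_error C Q TABK TS \<Delta> z w t)
          \<le> (N * (graph_norm A z + graph_norm S w) + 1) * t powr (- 1 / \<alpha>)" if "0 < t" for t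
      proof -
        have "(N * (graph_norm A z + graph_norm S w) + 1) * t powr (- 1 / \<alpha>)
            = N * t powr (- 1 / \<alpha>) * (graph_norm A z + graph_norm S w) + t powr (- 1 / \<alpha>)"
          by (simp add: algebra_simps)
        then show ?thesis
          using le[OF that] powr_ge_zero[of t "- 1 / \<alpha>"] by linarith
      qed
      moreover have "0 < N * (graph_norm A z + graph_norm S w) + 1"
        using N graph_norm_nonneg[of A z] graph_norm_nonneg[of S w] by (intro add_nonneg_pos) auto
      ultimately show ?thesis
        by blast
    qed
    ultimately have "solves_SFRP DA A B C DS TS P Q K L TABK"
      using assms(8-12) \<alpha> unfolding solves_SFRP_def Let_def G_fun \<Delta>_fun by blast
    moreover have "\<exists>\<beta>>0. \<exists>N>0. \<forall>z0\<in>DA. \<forall>w0\<in>DS. \<forall>t>0. norm (tracking_error C Q TABK TS \<Delta> z0 w0 t)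
           \<le> N * t powr (- \<beta>) * (graph_norm A z0 + graph_norm S w0)"
      using rate[OF \<alpha>] \<alpha> by (intro exI[of _ "1 / \<alpha>"]) (auto simp: decay_exponent_def)
    ultimately show "conform TABK DS TS \<Delta> \<and> solves_SFRP DA A B C DS TS P Q K L TABK \<and>
      (\<exists>\<beta>>0. \<exists>M>0. \<forall>z0\<in>DA. \<forall>w0\<in>DS. \<forall>t>0. norm (tracking_error C Q TABK TS \<Delta> z0 w0 t)
           \<le> M * t powr (- \<beta>) * (graph_norm A z0 + graph_norm S w0))"
      using sylvester_imp_conform[OF \<Pi>\<^sub>0 \<alpha>] by blast
  qed
qed

end
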